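(* Let $(G,w)$ be a vertex-weighted graph and let $f$ be an expression for which $Var(f)$ is defined, with a fixed total ordering $<$ on $Var(f)$. Then $$ XB_{(G,w)}[f] = \sum_{(\gamma, \kappa)} (1+t)^{|B(\gamma)|}(-1)^{c(N(G,\gamma,\kappa))}\left(\prod_{v \in V(G)} \kappa(v)^{w(v)}\right), $$ where the sum runs over all acyclic biorientations $\gamma$ of $G$ and maps $\kappa: V(G) \rightarrow Var(f)$ such that for each edge $uv \in E(G)$: if $\kappa(u) < \kappa(v)$, then $uv$ is singly directed from $u$ to $v$; if $\kappa(u) = \kappa(v)$ has positive sign, then $uv$ is bidirected; if $\kappa(u) = \kappa(v)$ has negative sign, then $uv$ may be oriented in any of the three possible ways. (After summing, primed variables are replaced by their unprimed versions.)
   Context: A vertex-weighted graph $(G,w)$ is a finite graph $G$ (loops and multi-edges allowed) with $w:V(G)\to\mathbb{Z}^+$. The Tutte symmetric function is $XB_{(G,w)}=\sum_{\kappa}(1+t)^{e(\kappa)}\prod_{v}x_{\kappa(v)}^{w(v)}$ over all colourings $\kappa:V(G)\to\mathbb{Z}^+$, where $e(\kappa)$ is the number of edges whose endpoints get equal colours; coefficients lie in $\mathbb{C}[t]$, and plethysm acts on the $x$-variables with $t$ treated as a constant. A biorientation assigns to each edge either a single direction or both directions (a bidirected edge); $B(\gamma)$ is the set of bidirected edges. A biorientation is acyclic if it has no directed cycle using at least one singly directed edge. $N(G,\gamma,\kappa)$ is the graph with vertex set $V^-(G)$, the vertices $v$ with $\operatorname{sgn}(\kappa(v))=-1$, and edge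 set the bidirected edges of $\gamma$ with both endpoints in $V^-(G)$; $c(\cdot)$ is the number of connected components. Plethysm: $c[f]=c$; $p_n[c]=c$; $p_n[p_m]=p_{nm}$; $p_n[f+g]=p_n[f]+p_n[g]$; $p_n[fg]=p_n[f]p_n[g]$; $(fg)[h]=f[h]g[h]$; $(f+g)[h]=f[h]+g[h]$; $p_n[q]=q^n$; $\mathbf{x}=x_1+x_2+\cdots$, $\mathbf{x}_n=x_1+\cdots+x_n$; $p_n[\epsilon g]=(-1)^np_n[g]$. Variable sets: each variable $z$ has a formal sign $\operatorname{sgn}(z)\in\{\pm1\}$, base variables positive. $Var(1)=\{1\}$; $Var(q)=\{q\}$; $Var(\mathbf{x}_n)=\{x_1,\dots,x_n\}$; $Var(\mathbf{x})=\{x_1,x_2,\dots\}$; $Var(f+g)=Var(f)\cup Var(g)\cup(Var(f)\cap Var(g))'$ where $z'$ is a formally distinct duplicate of $z$ (same value and sign) later replaced by $z$; $Var(-f)=\{\overline z\}$ where $\overline z$ has the same value as $z$ and opposite sign; $Var(\epsilon f)=\{-z\}$ (value negated, sign unchanged); $Var(fg)=\{zw\}$ with $\operatorname{sgn}(zw)=\operatorname{sgn}(z)\operatorname{sgn}(w)$. $\kappa(v)^{w(v)}$ is the value of $\kappa(v)$ raised to $w(v)$. *)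

theory Defs
  imports
    "HOL-Library.Multiset"
    "HOL-Library.FuncSet"
    "HOL-Library.Uprod"
    "HOL-Computational_Algebra.Polynomial"
    Complex_Main
begin

text \<open>
  A monomial in variables of type \<open>'x\<close> is a finite multiset of variables, and a power series
  assigns a coefficient to every monomial.
\<close>

typedef ('x, 'a) mseries = "UNIV :: ('x multiset \<Rightarrow> 'a) set"
  morphisms coeff_of Mseries ..

lemma coeff_of_Mseries [simp]: "coeff_of (Mseries f) = f"
  by (simp add: Mseries_inverse)

lemma mseries_eqI: "(\<And>m. coeff_of F m = coeff_of G m) \<Longrightarrow> F = G"
  by (metis coeff_of_inject ext)

definition splits :: "'x multiset \<Rightarrow> ('x multiset \<times> 'x multiset) set" where
  "splits m = {(a, b). a + b = m}"

lemma finite_submultisets: "finite {a. a \<subseteq># m}"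
proof (induction m)
  case empty
  show ?case by simp
next
  case (add x m)
  have "{a. a \<subseteq># add_mset x m} \<subseteq> {a. a \<subseteq># m} \<union> add_mset x ` {a. a \<subseteq># m}"
  proof
    fix a assume "a \<in> {a. a \<subseteq># add_mset x m}"
    then have a: "a \<subseteq># add_mset x m" by simp
    show "a \<in> {a. a \<subseteq># m} \<union> add_mset x ` {a. a \<subseteq># m}"
    proof (cases "x \<in># a")
      case True
      then obtain b where b: "a = add_mset x b" by (metis insert_DiffM)
      with a have "b \<subseteq># m" by simp
      with b show ?thesis by blast
    next
      case False
      with a have "a \<subseteq># m"
        by (metis add_mset_remove_trivial diff_single_trivial subset_eq_diff_conv
            add_mset_add_single)
      then show ?thesis by blast
    qed
  qed
  with add.IH show ?case by (meson finite_UnI finite_imageI finite_subset)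
qed

lemma finite_splits [simp]: "finite (splits m)"
proof (rule finite_subset)
  show "splits m \<subseteq> {a. a \<subseteq># m} \<times> {a. a \<subseteq># m}"
    by (auto simp: splits_def)
  show "finite ({a. a \<subseteq># m} \<times> {a. a \<subseteq># m})"
    by (simp add: finite_submultisets)
qed

instantiation mseries :: (type, comm_ring_1) comm_ring_1
begin

definition zero_mseries :: "('a, 'b) mseries" where
  "0 = Mseries (\<lambda>m. 0)"

definition one_mseries :: "('a, 'b) mseries" where
  "1 = Mseries (\<lambda>m. if m = {#} then 1 else 0)"

definition plus_mseries :: "('a, 'b) mseries \<Rightarrow> ('a, 'b) mseries \<Rightarrow> ('a, 'b) mseries" where
  "F + G = Mseries (\<lambda>m. coeff_of F m + coeff_of G m)"

definition uminus_mseries :: "('a, 'b) mseries \<Rightarrow> ('a, 'b) mseries" where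
  "- F = Mseries (\<lambda>m. - coeff_of F m)"

definition minus_mseries :: "('a, 'b) mseries \<Rightarrow> ('a, 'b) mseries \<Rightarrow> ('a, 'b) mseries" where
  "F - G = Mseries (\<lambda>m. coeff_of F m - coeff_of G m)"

definition times_mseries :: "('a, 'b) mseries \<Rightarrow> ('a, 'b) mseries \<Rightarrow> ('a, 'b) mseries" where
  "F * G = Mseries (\<lambda>m. \<Sum>(a, b)\<in>splits m. coeff_of F a * coeff_of G b)"

instance
proof
  fix F G K :: "('a, 'b) mseries"
  show "F + G + K = F + (G + K)" "F + G = G + F" "0 + F = F" "- F + F = 0" "F - G = F + - G"
    by (auto intro!: mseries_eqI simp: plus_mseries_def zero_mseries_def uminus_mseries_def
        minus_mseries_def algebra_simps)
  show "(F + G) * K = F * K + G * K"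
    by (auto intro!: mseries_eqI simp: plus_mseries_def times_mseries_def algebra_simps
        sum.distrib case_prod_beta)
  show "F * G = G * F"
  proof (rule mseries_eqI)
    fix m
    have "(\<Sum>(a, b)\<in>splits m. coeff_of F a * coeff_of G b)
        = (\<Sum>(a, b)\<in>splits m. coeff_of G a * coeff_of F b)"
      by (rule sum.reindex_bij_witness[of _ prod.swap prod.swap])
        (auto simp: splits_def ac_simps)
    then show "coeff_of (F * G) m = coeff_of (G * F) m"
      by (simp add: times_mseries_def)
  qed
  show "1 * F = F"
  proof (rule mseries_eqI)
    fix m :: "'a multiset"
    let ?t = "\<lambda>p :: 'a multiset \<times> 'a multiset. (if fst p = {#} then 1 else 0) * coeff_of F (snd p)"
    have "?t p = 0" if "p \<in> splits m - {({#}, m)}" for p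
    proof -
      have "fst p \<noteq> {#}"
        using that unfolding splits_def by (cases p) force
      then show ?thesis by simp
    qed
    moreover have "({#}, m) \<in> splits m"
      by (simp add: splits_def)
    ultimately have "sum ?t (splits m) = sum ?t {({#}, m)}"
      by (intro sum.mono_neutral_right) auto
    then show "coeff_of (1 * F) m = coeff_of F m"
      by (simp add: times_mseries_def one_mseries_def case_prod_beta)
  qed
  show "(F * G) * K = F * (G * K)"
  proof (rule mseries_eqI)
    fix m
    let ?t = "\<lambda>a b c. coeff_of F a * coeff_of G b * coeff_of K c"
    have "coeff_of ((F * G) * K) m
        = (\<Sum>p\<in>splits m. \<Sum>q\<in>splits (fst p). ?t (fst q) (snd q) (snd p))"
      by (simp add: times_mseries_def case_prod_beta sum_distrib_right)
    also have "\<dots> = (\<Sum>(p, q)\<in>Sigma (splits m) (\<lambda>p. splits (fst p)). ?t (fst q) (snd q) (snd p))"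
      by (rule sum.Sigma) simp_all
    also have "\<dots> = (\<Sum>(p, q)\<in>Sigma (splits m) (\<lambda>p. splits (snd p)). ?t (fst p) (fst q) (snd q))"
      by (rule sum.reindex_bij_witness[of _
            "\<lambda>(p, q). ((fst p + fst q, snd q), (fst p, fst q))"
            "\<lambda>(p, q). ((fst q, snd q + snd p), (snd q, snd p))"])
        (auto simp: splits_def ac_simps)
    also have "\<dots> = (\<Sum>p\<in>splits m. \<Sum>q\<in>splits (snd p). ?t (fst p) (fst q) (snd q))"
      by (rule sum.Sigma[symmetric]) simp_all
    also have "\<dots> = coeff_of (F * (G * K)) m"
      by (simp add: times_mseries_def case_prod_beta sum_distrib_left mult.assoc)
    finally show "coeff_of ((F * G) * K) m = coeff_of (F * (G * K)) m" .
  qed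
  have "coeff_of (0 :: ('a, 'b) mseries) {#} \<noteq> coeff_of 1 {#}"
    by (simp add: zero_mseries_def one_mseries_def)
  then show "(0 :: ('a, 'b) mseries) \<noteq> 1"
    by auto
qed

end

definition mconst :: "'a \<Rightarrow> ('x, 'a::comm_ring_1) mseries" where
  "mconst c = Mseries (\<lambda>m. if m = {#} then c else 0)"

definition mvar :: "'x \<Rightarrow> ('x, 'a::comm_ring_1) mseries" where
  "mvar z = Mseries (\<lambda>m. if m = {#z#} then 1 else 0)"

text \<open>
  Infinite families are summed coefficientwise; this is meaningful when every monomial occurs
  in only finitely many members of the family.
\<close>

definition formally_summable ::
  "('i \<Rightarrow> ('x, 'a::comm_ring_1) mseries) \<Rightarrow> 'i set \<Rightarrow> bool" where
  "formally_summable F A \<longleftrightarrow> (\<forall>m. finite {i \<in> A. coeff_of (F i) m \<noteq> 0})"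

definition formal_sum ::
  "('i \<Rightarrow> ('x, 'a::comm_ring_1) mseries) \<Rightarrow> 'i set \<Rightarrow> ('x, 'a) mseries" where
  "formal_sum F A = Mseries (\<lambda>m. \<Sum>i | i \<in> A \<and> coeff_of (F i) m \<noteq> 0. coeff_of (F i) m)"

text \<open>
  The base variables are \<open>q\<close> and \<open>x\<^sub>1, x\<^sub>2, \<dots>\<close>; the index \<open>0\<close> is never used. The coefficient
  ring \<open>\<complex>[t]\<close> is the type of complex polynomials, with \<open>t = [:0, 1:]\<close>.
\<close>

datatype base_var = Q | X nat

type_synonym series = "(base_var, complex poly) mseries"

datatype expr =
    One
  | Qvar
  | Xfin nat          \<comment> \<open>\<open>x\<^sub>1 + \<dots> + x\<^sub>n\<close>\<close>
  | Xinf              \<comment> \<open>\<open>x\<^sub>1 + x\<^sub>2 + \<dots>\<close>\<close>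
  | Add expr expr
  | Neg expr
  | Eps expr          \<comment> \<open>the formal symbol \<open>\<epsilon>\<close> applied to an expression\<close>
  | Mul expr expr

definition power_sum :: "nat \<Rightarrow> series" where
  "power_sum n = formal_sum (\<lambda>i. mvar (X i) ^ n) {1..}"

text \<open>
  \<open>power_sum_of n f\<close> is \<open>p\<^sub>n[f]\<close>. The clause for \<open>Neg\<close> comes from \<open>p\<^sub>n[(-1) f] = p\<^sub>n[-1] p\<^sub>n[f]\<close>
  and \<open>p\<^sub>n[-1] = -1\<close>; the one for \<open>Xinf\<close> is \<open>p\<^sub>n[p\<^sub>1] = p\<^sub>n\<close>; the one for \<open>Xfin\<close> applies the rule
  \<open>p\<^sub>n[q] = q\<^sup>n\<close> to the variables \<open>x\<^sub>i\<close>. Only \<open>n \<ge> 1\<close> is relevant.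
\<close>

primrec power_sum_of :: "nat \<Rightarrow> expr \<Rightarrow> series" where
  "power_sum_of n One = 1"
| "power_sum_of n Qvar = mvar Q ^ n"
| "power_sum_of n (Xfin k) = (\<Sum>i = 1..k. mvar (X i) ^ n)"
| "power_sum_of n Xinf = power_sum n"
| "power_sum_of n (Add f g) = power_sum_of n f + power_sum_of n g"
| "power_sum_of n (Neg f) = - power_sum_of n f"
| "power_sum_of n (Eps f) = (- 1) ^ n * power_sum_of n f"
| "power_sum_of n (Mul f g) = power_sum_of n f * power_sum_of n g"

text \<open>
  \<open>plethysm_rel f F R\<close> holds when the defining rules of plethysm yield \<open>F[f] = R\<close>. The first
  arguments \<open>F\<close> that occur are the polynomials over \<open>\<complex>[t]\<close> in the power sums, i.e. the symmetric
  functions; there \<open>R\<close> is unique because the power sums are algebraically independent.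
\<close>

inductive plethysm_rel :: "expr \<Rightarrow> series \<Rightarrow> series \<Rightarrow> bool" for f :: expr where
  const: "plethysm_rel f (mconst c) (mconst c)"
| power_sum: "n \<ge> 1 \<Longrightarrow> plethysm_rel f (power_sum n) (power_sum_of n f)"
| add: "plethysm_rel f F R \<Longrightarrow> plethysm_rel f G S \<Longrightarrow> plethysm_rel f (F + G) (R + S)"
| mult: "plethysm_rel f F R \<Longrightarrow> plethysm_rel f G S \<Longrightarrow> plethysm_rel f (F * G) (R * S)"

definition plethysm :: "series \<Rightarrow> expr \<Rightarrow> series" where
  "plethysm F f = (THE R. plethysm_rel f F R)"

text \<open>
  Formal variables. The union of \<open>Var f\<close>, \<open>Var g\<close> and a fresh primed copy of
  \<open>Var f \<inter> Var g\<close> is the disjoint union of \<open>Var f\<close> and \<open>Var g\<close>, and it is encoded by tagging the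
  two summands; a tag changes neither value nor sign. (A prime that is merely applied to the
  common variables need not be fresh: compare \<open>(1 + 1) + (1 + 1)\<close>.) Likewise the products
  \<open>zw\<close> are kept formally distinct for distinct pairs \<open>(z, w)\<close>.
\<close>

datatype fvar =
    VOne
  | VQ
  | VX nat
  | InL fvar
  | InR fvar
  | Bar fvar          \<comment> \<open>same value, opposite sign\<close>
  | NegVal fvar       \<comment> \<open>negated value, same sign\<close>
  | ProdV fvar fvar

primrec Var :: "expr \<Rightarrow> fvar set" where
  "Var One = {VOne}"
| "Var Qvar = {VQ}"
| "Var (Xfin n) = VX ` {1..n}"
| "Var Xinf = VX ` {1..}"
| "Var (Add f g) = InL ` Var f \<union> InR ` Var g"
| "Var (Neg f) = Bar ` Var f"
| "Var (Eps f) = NegVal ` Var f"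
| "Var (Mul f g) = {ProdV z w | z w. z \<in> Var f \<and> w \<in> Var g}"

primrec sgn_of :: "fvar \<Rightarrow> int" where
  "sgn_of VOne = 1"
| "sgn_of VQ = 1"
| "sgn_of (VX i) = 1"
| "sgn_of (InL z) = sgn_of z"
| "sgn_of (InR z) = sgn_of z"
| "sgn_of (Bar z) = - sgn_of z"
| "sgn_of (NegVal z) = sgn_of z"
| "sgn_of (ProdV z w) = sgn_of z * sgn_of w"

primrec value_of :: "fvar \<Rightarrow> series" where
  "value_of VOne = 1"
| "value_of VQ = mvar Q"
| "value_of (VX i) = mvar (X i)"
| "value_of (InL z) = value_of z"
| "value_of (InR z) = value_of z"
| "value_of (Bar z) = value_of z"
| "value_of (NegVal z) = - value_of z"
| "value_of (ProdV z w) = value_of z * value_of w"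

record ('v, 'e) multigraph =
  verts :: "'v set"
  edges :: "'e set"
  ends :: "'e \<Rightarrow> 'v uprod"

definition vertex_weighted_graph :: "('v, 'e) multigraph \<Rightarrow> ('v \<Rightarrow> nat) \<Rightarrow> bool" where
  "vertex_weighted_graph G w \<longleftrightarrow>
     finite (verts G) \<and> finite (edges G) \<and>
     (\<forall>e \<in> edges G. set_uprod (ends G e) \<subseteq> verts G) \<and>
     (\<forall>v \<in> verts G. w v > 0)"

definition mono_edges :: "('v, 'e) multigraph \<Rightarrow> ('v \<Rightarrow> 'c) \<Rightarrow> 'e set" where
  "mono_edges G \<kappa> = {e \<in> edges G. \<exists>u v. ends G e = Upair u v \<and> \<kappa> u = \<kappa> v}"

definition XB :: "('v, 'e) multigraph \<Rightarrow> ('v \<Rightarrow> nat) \<Rightarrow> series" where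
  "XB G w = formal_sum
     (\<lambda>\<kappa>. mconst ([:1, 1:] ^ card (mono_edges G \<kappa>)) * (\<Prod>v\<in>verts G. mvar (X (\<kappa> v)) ^ w v))
     (verts G \<rightarrow>\<^sub>E {1..})"

text \<open>
  A loop at \<open>u\<close> distinguishes \<open>Single u u\<close> from \<open>Bidirected\<close>; the former is a directed cycle
  and so never occurs in an acyclic biorientation.
\<close>

datatype 'v direction = Single 'v 'v | Bidirected

definition biorientations :: "('v, 'e) multigraph \<Rightarrow> ('e \<Rightarrow> 'v direction) set" where
  "biorientations G =
     (\<Pi>\<^sub>E e\<in>edges G. insert Bidirected {Single u v | u v. ends G e = Upair u v})"

definition bidirected_edges :: "('v, 'e) multigraph \<Rightarrow> ('e \<Rightarrow> 'v direction) \<Rightarrow> 'e set" where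
  "bidirected_edges G \<gamma> = {e \<in> edges G. \<gamma> e = Bidirected}"

definition traverses ::
  "('v, 'e) multigraph \<Rightarrow> ('e \<Rightarrow> 'v direction) \<Rightarrow> 'e \<Rightarrow> 'v \<Rightarrow> 'v \<Rightarrow> bool" where
  "traverses G \<gamma> e u v \<longleftrightarrow>
     \<gamma> e = Single u v \<or> (\<gamma> e = Bidirected \<and> ends G e = Upair u v)"

text \<open>
  The edge \<open>es ! i\<close> leads from \<open>vs ! i\<close> to the cyclically next vertex. Length \<open>1\<close> is a loop,
  length \<open>2\<close> a pair of parallel edges.
\<close>

definition directed_cycle ::
  "('v, 'e) multigraph \<Rightarrow> ('e \<Rightarrow> 'v direction) \<Rightarrow> 'v list \<Rightarrow> 'e list \<Rightarrow> bool" where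
  "directed_cycle G \<gamma> vs es \<longleftrightarrow>
     vs \<noteq> [] \<and> length es = length vs \<and> distinct vs \<and> distinct es \<and> set es \<subseteq> edges G \<and>
     (\<forall>i < length vs. traverses G \<gamma> (es ! i) (vs ! i) (vs ! (Suc i mod length vs)))"

definition acyclic_biorientation :: "('v, 'e) multigraph \<Rightarrow> ('e \<Rightarrow> 'v direction) \<Rightarrow> bool" where
  "acyclic_biorientation G \<gamma> \<longleftrightarrow>
     \<not> (\<exists>vs es. directed_cycle G \<gamma> vs es \<and> (\<exists>e \<in> set es. \<gamma> e \<noteq> Bidirected))"

definition neg_subgraph ::
  "('v, 'e) multigraph \<Rightarrow> ('e \<Rightarrow> 'v direction) \<Rightarrow> ('v \<Rightarrow> fvar) \<Rightarrow> ('v, 'e) multigraph" where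
  "neg_subgraph G \<gamma> \<kappa> =
     \<lparr>verts = {v \<in> verts G. sgn_of (\<kappa> v) = - 1},
      edges = {e \<in> bidirected_edges G \<gamma>.
                 set_uprod (ends G e) \<subseteq> {v \<in> verts G. sgn_of (\<kappa> v) = - 1}},
      ends = ends G\<rparr>"

definition adjacency :: "('v, 'e) multigraph \<Rightarrow> 'v rel" where
  "adjacency G = {(u, v). \<exists>e \<in> edges G. ends G e = Upair u v}"

definition num_components :: "('v, 'e) multigraph \<Rightarrow> nat" where
  "num_components G = card (verts G // {(u, v) \<in> verts G \<times> verts G. (u, v) \<in> (adjacency G)\<^sup>*})"

text \<open>
  The endpoints of an edge are unordered, so the condition ranges over both readings
  \<open>Upair u v\<close> and \<open>Upair v u\<close>. An edge with two endpoints of the same negative colour is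
  unconstrained.
\<close>

definition compatible ::
  "('v, 'e) multigraph \<Rightarrow> fvar rel \<Rightarrow> ('e \<Rightarrow> 'v direction) \<Rightarrow> ('v \<Rightarrow> fvar) \<Rightarrow> bool" where
  "compatible G lt \<gamma> \<kappa> \<longleftrightarrow>
     (\<forall>e \<in> edges G. \<forall>u v. ends G e = Upair u v \<longrightarrow>
        ((\<kappa> u, \<kappa> v) \<in> lt \<longrightarrow> \<gamma> e = Single u v) \<and>
        (\<kappa> u = \<kappa> v \<and> sgn_of (\<kappa> u) = 1 \<longrightarrow> \<gamma> e = Bidirected))"

definition admissible_pairs ::
  "('v, 'e) multigraph \<Rightarrow> expr \<Rightarrow> fvar rel \<Rightarrow> (('e \<Rightarrow> 'v direction) \<times> ('v \<Rightarrow> fvar)) set" where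
  "admissible_pairs G f lt =
     {(\<gamma>, \<kappa>). \<gamma> \<in> biorientations G \<and> acyclic_biorientation G \<gamma> \<and>
              \<kappa> \<in> verts G \<rightarrow>\<^sub>E Var f \<and> compatible G lt \<gamma> \<kappa>}"

definition pair_term ::
  "('v, 'e) multigraph \<Rightarrow> ('v \<Rightarrow> nat) \<Rightarrow> ('e \<Rightarrow> 'v direction) \<times> ('v \<Rightarrow> fvar) \<Rightarrow> series" where
  "pair_term G w = (\<lambda>(\<gamma>, \<kappa>).
     mconst ([:1, 1:] ^ card (bidirected_edges G \<gamma>))
       * (- 1) ^ num_components (neg_subgraph G \<gamma> \<kappa>)
       * (\<Prod>v\<in>verts G. value_of (\<kappa> v) ^ w v))"

end

theory Submission
  imports Defs
begin

text \<open>
  Expanding every factor \<open>1 + t\<close> of \<open>XB\<close> over the sets \<open>S\<close> of monochromatic edges gives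
  \<open>XB = \<Sum>\<^sub>S t\<^bsup>|S|\<^esup> \<Prod>\<^sub>C p\<^bsub>w(C)\<^esub>\<close>, where \<open>C\<close> runs over the connected components of
  \<open>(V, S)\<close>. Since \<open>p\<^sub>n[f]\<close> is the sum of \<open>sgn(z) z\<^sup>n\<close> over \<open>Var f\<close>, the coefficient in \<open>XB[f]\<close> of
  a colouring \<open>\<kappa>\<close> is the sum over all sets \<open>S\<close> of monochromatic edges of \<open>t\<^bsup>|S|\<^esup>\<close> times the
  product of the signs of the components of \<open>(V, S)\<close>. Monochromatic edges of positive colour
  contribute a power of \<open>1 + t\<close>, and for those of negative colour there remains the identity
  \<open>\<Sum>\<^sub>S t\<^bsup>|S|\<^esup> (-1)\<^bsup>c(S)\<^esup> = \<Sum>\<^sub>\<gamma> (1+t)\<^bsup>|B(\<gamma>)|\<^esup> (-1)\<^bsup>c(B(\<gamma>))\<^esup>\<close> over acyclic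
  biorientations \<open>\<gamma>\<close>, which is proved by deletion and contraction.
\<close>

section \<open>Formal sums\<close>

text \<open>\<open>plethysm\<close> is a definite description, so no value XB[f] can be computed
  before \<open>plethysm_rel\<close> is known to be single-valued; this is what the algebraic
  independence of the power sums is for. \<open>Var f\<close> may be infinite, hence every expansion
  is an identity of formal sums, and summability rests on the weights being positive: in the power 0
  every variable would contribute the monomial 1. The expansion over edge sets is stated for an
  arbitrary signed alphabet and used twice, with x_1, x_2, ... and signs +1 to write XB in power
  sums, and with \<open>Var f\<close> after plethysm. Orientations reduce to edges of negative
  colour because an edge between different colours points upwards: a directed cycle cannot change
  its colour, and within a positive colour there are no single arcs. Contracting an edge literally
  would alter the vertex set and the ends of the other edges. Instead the graph stays and the
  contracted edge joins a symmetric relation, modulo which components and cycles are measured.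
  Cycles themselves are replaced by reachability in transitive closures, which behave well when an
  edge is added.\<close>

lemma coeff_of_0 [simp]: "coeff_of 0 m = 0"
  by (simp add: zero_mseries_def)

lemma coeff_of_add [simp]: "coeff_of (F + G) m = coeff_of F m + coeff_of G m"
  by (simp add: plus_mseries_def)

lemma coeff_of_uminus [simp]: "coeff_of (- F) m = - coeff_of F m"
  by (simp add: uminus_mseries_def)

lemma coeff_of_1: "coeff_of 1 m = (if m = {#} then 1 else 0)"
  by (simp add: one_mseries_def)

lemma coeff_of_mult: "coeff_of (F * G) m = (\<Sum>(a, b)\<in>splits m. coeff_of F a * coeff_of G b)"
  by (simp add: times_mseries_def)

lemma coeff_of_sum [simp]: "coeff_of (sum F A) m = (\<Sum>i\<in>A. coeff_of (F i) m)"
  by (induction A rule: infinite_finite_induct) auto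

lemma coeff_of_mconst_mult [simp]:
  fixes F :: "('x, 'a::comm_ring_1) mseries"
  shows "coeff_of (mconst c * F) m = c * coeff_of F m"
proof -
  let ?t = "\<lambda>(a :: 'x multiset, b). (if a = {#} then c else 0) * coeff_of F b"
  have "sum ?t (splits m) = sum ?t {({#}, m)}"
    by (rule sum.mono_neutral_right[OF finite_splits]) (auto simp: splits_def split: if_splits)
  then show ?thesis
    by (simp add: coeff_of_mult mconst_def case_prod_beta)
qed

lemma mconst_1 [simp]: "mconst 1 = 1"
  by (simp add: mconst_def one_mseries_def)

lemma mconst_0 [simp]: "mconst 0 = 0"
  by (simp add: mconst_def zero_mseries_def)

lemma mconst_uminus: "mconst (- a) = - mconst a"
  by (rule mseries_eqI) (simp add: mconst_def)

lemma mconst_add: "mconst (a + b) = mconst a + mconst b"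
  by (rule mseries_eqI) (simp add: mconst_def)

lemma mconst_mult: "mconst (a * b) = mconst a * mconst b"
  by (rule mseries_eqI) (simp, simp add: mconst_def)

lemma mconst_sum: "mconst (sum f A) = (\<Sum>i\<in>A. mconst (f i))"
  by (induction A rule: infinite_finite_induct) (auto simp: mconst_add)

lemma mconst_power: "mconst (a ^ n) = mconst a ^ n"
  by (induction n) (auto simp: mconst_mult)

lemma mconst_prod: "mconst (prod f A) = (\<Prod>i\<in>A. mconst (f i))"
  by (induction A rule: infinite_finite_induct) (auto simp: mconst_mult)

lemma mconst_of_int: "mconst (of_int k) = of_int k"
proof -
  have "mconst (of_nat n) = of_nat n" for n
    by (induction n) (auto simp: mconst_add)
  then show ?thesis
    by (cases k rule: int_cases2) (auto simp: mconst_uminus)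
qed

text \<open>The definition sums over the exact support, which varies with the family and the
  monomial. Allowing any finite set between the support and \<open>A\<close> lets several
  coefficients be compared over one common index set.\<close>

lemma coeff_of_formal_sum_eq:
  assumes "finite B" "B \<subseteq> A" "{i \<in> A. coeff_of (F i) m \<noteq> 0} \<subseteq> B"
  shows "coeff_of (formal_sum F A) m = (\<Sum>i\<in>B. coeff_of (F i) m)"
  unfolding formal_sum_def using assms
  by (simp, intro sum.mono_neutral_left) auto

lemma formal_sum_finite:
  assumes "finite A"
  shows "formally_summable F A" "formal_sum F A = sum F A"
  using assms
  by (auto simp: formally_summable_def coeff_of_formal_sum_eq[of A] intro!: mseries_eqI)

lemma formally_summable_reindex:
  assumes "inj_on h B"
  shows "formally_summable F (h ` B) \<longleftrightarrow> formally_summable (\<lambda>b. F (h b)) B"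
proof -
  have "{i \<in> h ` B. coeff_of (F i) m \<noteq> 0} = h ` {b \<in> B. coeff_of (F (h b)) m \<noteq> 0}" for m
    by auto
  moreover have "inj_on h {b \<in> B. coeff_of (F (h b)) m \<noteq> 0}" for m
    using assms by (rule inj_on_subset) auto
  ultimately show ?thesis
    by (simp add: formally_summable_def finite_image_iff)
qed

lemma formal_sum_reindex:
  assumes "inj_on h B"
  shows "formal_sum F (h ` B) = formal_sum (\<lambda>b. F (h b)) B"
proof (rule mseries_eqI)
  fix m
  have "{i \<in> h ` B. coeff_of (F i) m \<noteq> 0} = h ` {b \<in> B. coeff_of (F (h b)) m \<noteq> 0}"
    by auto
  moreover have "inj_on h {b \<in> B. coeff_of (F (h b)) m \<noteq> 0}"
    using assms by (rule inj_on_subset) auto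
  ultimately show "coeff_of (formal_sum F (h ` B)) m = coeff_of (formal_sum (\<lambda>b. F (h b)) B) m"
    by (simp add: formal_sum_def sum.reindex)
qed

lemma formally_summable_cong:
  assumes "\<And>i. i \<in> A \<Longrightarrow> F i = G i"
  shows "formally_summable F A \<longleftrightarrow> formally_summable G A"
proof -
  have "{i \<in> A. coeff_of (F i) m \<noteq> 0} = {i \<in> A. coeff_of (G i) m \<noteq> 0}" for m
    using assms by auto
  then show ?thesis
    by (simp add: formally_summable_def)
qed

lemma formal_sum_cong:
  assumes "\<And>i. i \<in> A \<Longrightarrow> F i = G i"
  shows "formal_sum F A = formal_sum G A"
proof -
  have "{i \<in> A. coeff_of (F i) m \<noteq> 0} = {i \<in> A. coeff_of (G i) m \<noteq> 0}" for m
    using assms by auto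
  then show ?thesis
    by (auto intro!: mseries_eqI sum.cong simp: formal_sum_def assms)
qed

lemma formally_summable_mult_left:
  assumes "formally_summable F A"
  shows "formally_summable (\<lambda>i. mconst (c i) * F i) A"
proof -
  have "{i \<in> A. coeff_of (mconst (c i) * F i) m \<noteq> 0} \<subseteq> {i \<in> A. coeff_of (F i) m \<noteq> 0}" for m
    by auto
  then show ?thesis
    using assms unfolding formally_summable_def by (blast intro: finite_subset)
qed

lemma formal_sum_mult_left:
  assumes "formally_summable F A"
  shows "formal_sum (\<lambda>i. mconst c * F i) A = mconst c * formal_sum F A"
proof (rule mseries_eqI)
  fix m
  let ?B = "{i \<in> A. coeff_of (F i) m \<noteq> 0}"
  have "finite ?B"
    using assms by (simp add: formally_summable_def)
  then show "coeff_of (formal_sum (\<lambda>i. mconst c * F i) A) m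
      = coeff_of (mconst c * formal_sum F A) m"
    by (subst coeff_of_formal_sum_eq[of ?B])
      (auto simp: coeff_of_formal_sum_eq[of ?B] sum_distrib_left)
qed

lemma formal_sum_sum:
  assumes "finite S" "\<And>s. s \<in> S \<Longrightarrow> formally_summable (F s) A"
  shows "(\<Sum>s\<in>S. formal_sum (F s) A) = formal_sum (\<lambda>i. \<Sum>s\<in>S. F s i) A"
proof (rule mseries_eqI)
  fix m
  let ?B = "\<Union>s\<in>S. {i \<in> A. coeff_of (F s i) m \<noteq> 0}"
  have fin: "finite ?B"
    using assms by (auto simp: formally_summable_def)
  have "coeff_of (\<Sum>s\<in>S. formal_sum (F s) A) m = (\<Sum>s\<in>S. \<Sum>i\<in>?B. coeff_of (F s i) m)"
    using fin by (simp, intro sum.cong refl coeff_of_formal_sum_eq) auto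
  also have "\<dots> = (\<Sum>i\<in>?B. \<Sum>s\<in>S. coeff_of (F s i) m)"
    by (rule sum.swap)
  also have "\<dots> = coeff_of (formal_sum (\<lambda>i. \<Sum>s\<in>S. F s i) A) m"
  proof -
    have "{i \<in> A. coeff_of (\<Sum>s\<in>S. F s i) m \<noteq> 0} \<subseteq> ?B"
      by (auto dest: sum.not_neutral_contains_not_neutral)
    with fin show ?thesis
      by (subst coeff_of_formal_sum_eq[of ?B]) auto
  qed
  finally show "coeff_of (\<Sum>s\<in>S. formal_sum (F s) A) m
      = coeff_of (formal_sum (\<lambda>i. \<Sum>s\<in>S. F s i) A) m" .
qed

lemma formally_summable_Un:
  "formally_summable F (A \<union> B) \<longleftrightarrow> formally_summable F A \<and> formally_summable F B"
proof -
  have "{i \<in> A \<union> B. coeff_of (F i) m \<noteq> 0}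
      = {i \<in> A. coeff_of (F i) m \<noteq> 0} \<union> {i \<in> B. coeff_of (F i) m \<noteq> 0}" for m
    by auto
  then show ?thesis
    by (auto simp: formally_summable_def)
qed

lemma formal_sum_Un_disjoint:
  assumes "formally_summable F A" "formally_summable F B" "A \<inter> B = {}"
  shows "formal_sum F (A \<union> B) = formal_sum F A + formal_sum F B"
proof (rule mseries_eqI)
  fix m
  have "{i \<in> A \<union> B. coeff_of (F i) m \<noteq> 0}
      = {i \<in> A. coeff_of (F i) m \<noteq> 0} \<union> {i \<in> B. coeff_of (F i) m \<noteq> 0}"
    by auto
  then show "coeff_of (formal_sum F (A \<union> B)) m = coeff_of (formal_sum F A + formal_sum F B) m"
    using assms by (simp add: formal_sum_def formally_summable_def, intro sum.union_disjoint) auto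
qed

lemma formal_sum_mono_neutral:
  assumes "A \<subseteq> B" "\<And>i. i \<in> B - A \<Longrightarrow> F i = 0"
  shows "formally_summable F A \<longleftrightarrow> formally_summable F B" "formal_sum F A = formal_sum F B"
proof -
  have "{i \<in> A. coeff_of (F i) m \<noteq> 0} = {i \<in> B. coeff_of (F i) m \<noteq> 0}" for m
    using assms by fastforce
  then show "formally_summable F A \<longleftrightarrow> formally_summable F B" "formal_sum F A = formal_sum F B"
    by (simp_all add: formally_summable_def formal_sum_def)
qed

text \<open>A monomial has only finitely many factorisations, and each factor occurs in finitely
  many members of its family. \<open>?A m\<close> and \<open>?B m\<close> collect these members over
  all factorisations of \<open>m\<close>, so one finite rectangle serves every term of the
  convolution and the sums may be interchanged.\<close>

lemma formal_sum_mult: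
  assumes F: "formally_summable F A" and G: "formally_summable G B"
  shows "formally_summable (\<lambda>p. F (fst p) * G (snd p)) (A \<times> B)" (is ?S)
    and "formal_sum F A * formal_sum G B = formal_sum (\<lambda>p. F (fst p) * G (snd p)) (A \<times> B)" (is ?E)
proof -
  let ?A = "\<lambda>m. \<Union>p\<in>splits m. {i \<in> A. coeff_of (F i) (fst p) \<noteq> 0}"
  let ?B = "\<lambda>m. \<Union>p\<in>splits m. {j \<in> B. coeff_of (G j) (snd p) \<noteq> 0}"
  have finA: "finite (?A m)" and finB: "finite (?B m)" for m
    using F G by (auto simp: formally_summable_def)
  have sub: "{p \<in> A \<times> B. coeff_of (F (fst p) * G (snd p)) m \<noteq> 0} \<subseteq> ?A m \<times> ?B m" for m
  proof
    fix p assume "p \<in> {p \<in> A \<times> B. coeff_of (F (fst p) * G (snd p)) m \<noteq> 0}"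
    then have p: "p \<in> A \<times> B" and "coeff_of (F (fst p) * G (snd p)) m \<noteq> 0"
      by auto
    then have "\<exists>ab\<in>splits m. coeff_of (F (fst p)) (fst ab) * coeff_of (G (snd p)) (snd ab) \<noteq> 0"
      unfolding coeff_of_mult case_prod_beta by (meson sum.neutral)
    then obtain ab where ab: "ab \<in> splits m"
      "coeff_of (F (fst p)) (fst ab) * coeff_of (G (snd p)) (snd ab) \<noteq> 0"
      by blast
    from ab(2) have "coeff_of (F (fst p)) (fst ab) \<noteq> 0" "coeff_of (G (snd p)) (snd ab) \<noteq> 0"
      by (auto simp: case_prod_beta)
    with p ab(1) show "p \<in> ?A m \<times> ?B m"
      by (auto simp: mem_Times_iff intro!: bexI[of _ ab])
  qed
  show ?S
    unfolding formally_summable_def using sub finA finB by (meson finite_SigmaI finite_subset)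
  show ?E
  proof (rule mseries_eqI)
    fix m
    have "coeff_of (formal_sum (\<lambda>p. F (fst p) * G (snd p)) (A \<times> B)) m
        = (\<Sum>p\<in>?A m \<times> ?B m. coeff_of (F (fst p) * G (snd p)) m)"
      using finA finB sub[of m] by (intro coeff_of_formal_sum_eq) auto
    also have "\<dots> = (\<Sum>i\<in>?A m. \<Sum>j\<in>?B m. coeff_of (F i * G j) m)"
      by (simp add: sum.cartesian_product case_prod_beta)
    also have "\<dots> = (\<Sum>i\<in>?A m. \<Sum>j\<in>?B m. \<Sum>p\<in>splits m.
        coeff_of (F i) (fst p) * coeff_of (G j) (snd p))"
      by (simp add: coeff_of_mult case_prod_beta)
    also have "\<dots> = (\<Sum>i\<in>?A m. \<Sum>p\<in>splits m. \<Sum>j\<in>?B m.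
        coeff_of (F i) (fst p) * coeff_of (G j) (snd p))"
      by (subst sum.swap) (rule refl)
    also have "\<dots> = (\<Sum>p\<in>splits m. \<Sum>i\<in>?A m. \<Sum>j\<in>?B m.
        coeff_of (F i) (fst p) * coeff_of (G j) (snd p))"
      by (rule sum.swap)
    also have "\<dots> = (\<Sum>p\<in>splits m. (\<Sum>i\<in>?A m. coeff_of (F i) (fst p))
        * (\<Sum>j\<in>?B m. coeff_of (G j) (snd p)))"
      by (simp add: sum_product)
    also have "\<dots> = (\<Sum>p\<in>splits m. coeff_of (formal_sum F A) (fst p)
        * coeff_of (formal_sum G B) (snd p))"
    proof (rule sum.cong[OF refl])
      fix p assume p: "p \<in> splits m"
      have "coeff_of (formal_sum F A) (fst p) = (\<Sum>i\<in>?A m. coeff_of (F i) (fst p))"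
        using p by (intro coeff_of_formal_sum_eq finA) auto
      moreover have "coeff_of (formal_sum G B) (snd p) = (\<Sum>j\<in>?B m. coeff_of (G j) (snd p))"
        using p by (intro coeff_of_formal_sum_eq finB) auto
      ultimately show "(\<Sum>i\<in>?A m. coeff_of (F i) (fst p)) * (\<Sum>j\<in>?B m. coeff_of (G j) (snd p))
        = coeff_of (formal_sum F A) (fst p) * coeff_of (formal_sum G B) (snd p)"
        by simp
    qed
    finally show "coeff_of (formal_sum F A * formal_sum G B) m
        = coeff_of (formal_sum (\<lambda>p. F (fst p) * G (snd p)) (A \<times> B)) m"
      by (simp add: coeff_of_mult case_prod_beta)
  qed
qed

text \<open>The distributive law over choice functions. Summability and value are proved together
  because each induction step multiplies by a family already known to be summable.\<close>

lemma formal_sum_prod: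
  assumes "finite I" "\<And>i. i \<in> I \<Longrightarrow> formally_summable (F i) (A i)"
  shows "formally_summable (\<lambda>g. \<Prod>i\<in>I. F i (g i)) (Pi\<^sub>E I A)
    \<and> (\<Prod>i\<in>I. formal_sum (F i) (A i)) = formal_sum (\<lambda>g. \<Prod>i\<in>I. F i (g i)) (Pi\<^sub>E I A)"
  using assms
proof (induction I rule: finite_induct)
  case empty
  show ?case
    by (simp add: formal_sum_finite)
next
  case (insert j I)
  let ?h = "\<lambda>(y, g). g(j := y)"
  let ?F = "\<lambda>g. \<Prod>i\<in>insert j I. F i (g i)"
  have IH: "formally_summable (\<lambda>g. \<Prod>i\<in>I. F i (g i)) (Pi\<^sub>E I A)"
      "(\<Prod>i\<in>I. formal_sum (F i) (A i)) = formal_sum (\<lambda>g. \<Prod>i\<in>I. F i (g i)) (Pi\<^sub>E I A)"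
    and j: "formally_summable (F j) (A j)"
    using insert by auto
  have inj: "inj_on ?h (A j \<times> Pi\<^sub>E I A)"
    using insert.hyps(2) by (rule inj_combinator)
  have eq: "?F (?h p) = F j (fst p) * (\<Prod>i\<in>I. F i (snd p i))" for p
  proof -
    have "(\<Prod>i\<in>I. F i (?h p i)) = (\<Prod>i\<in>I. F i (snd p i))"
      using insert.hyps by (intro prod.cong) (auto simp: case_prod_beta)
    then show ?thesis
      using insert.hyps by (simp add: case_prod_beta)
  qed
  note m = formal_sum_mult[OF j IH(1)]
  show ?case
    unfolding PiE_insert_eq formally_summable_reindex[OF inj] formal_sum_reindex[OF inj] eq
    using m IH(2) insert.hyps by simp
qed

text \<open>Only the outer index may be infinite; a finite fibre contributes nothing but scalars and
  can be summed inside the coefficient. In the application \<open>k\<close> is a colouring and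
  \<open>i\<close> an orientation compatible with it.\<close>

lemma formal_sum_Sigma:
  fixes b :: "'k \<Rightarrow> ('x, 'a::comm_ring_1) mseries" and c :: "'k \<Rightarrow> 'i \<Rightarrow> 'a"
  assumes K: "formally_summable b K" and fin: "\<And>k. k \<in> K \<Longrightarrow> finite (I k)"
  defines "F \<equiv> \<lambda>p. mconst (c (fst p) (snd p)) * b (fst p)"
  shows "formally_summable F (Sigma K I)"
    and "formal_sum F (Sigma K I) = formal_sum (\<lambda>k. mconst (\<Sum>i\<in>I k. c k i) * b k) K"
proof -
  let ?K = "\<lambda>m. {k \<in> K. coeff_of (b k) m \<noteq> 0}"
  have finK: "finite (?K m)" for m
    using K by (simp add: formally_summable_def)
  have finS: "finite (Sigma (?K m) I)" for m
    using finK fin by (intro finite_SigmaI) auto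
  have sub: "{p \<in> Sigma K I. coeff_of (F p) m \<noteq> 0} \<subseteq> Sigma (?K m) I" for m
    by (auto simp: F_def)
  show "formally_summable F (Sigma K I)"
    unfolding formally_summable_def using sub finS by (blast intro: finite_subset)
  show "formal_sum F (Sigma K I) = formal_sum (\<lambda>k. mconst (\<Sum>i\<in>I k. c k i) * b k) K"
  proof (rule mseries_eqI)
    fix m
    have "coeff_of (formal_sum F (Sigma K I)) m = (\<Sum>p\<in>Sigma (?K m) I. coeff_of (F p) m)"
      using sub finS by (intro coeff_of_formal_sum_eq) auto
    also have "\<dots> = (\<Sum>k\<in>?K m. \<Sum>i\<in>I k. c k i * coeff_of (b k) m)"
      using finK fin by (subst sum.Sigma) (auto simp: F_def case_prod_beta)
    also have "\<dots> = (\<Sum>k\<in>?K m. coeff_of (mconst (\<Sum>i\<in>I k. c k i) * b k) m)"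
      by (simp add: sum_distrib_right)
    also have "\<dots> = coeff_of (formal_sum (\<lambda>k. mconst (\<Sum>i\<in>I k. c k i) * b k) K) m"
      using finK by (intro coeff_of_formal_sum_eq[symmetric]) auto
    finally show "coeff_of (formal_sum F (Sigma K I)) m
      = coeff_of (formal_sum (\<lambda>k. mconst (\<Sum>i\<in>I k. c k i) * b k) K) m" .
  qed
qed

section \<open>Algebraic independence of the power sums\<close>

lemma coeff_of_mvar: "coeff_of (mvar z) m = (if m = {#z#} then 1 else 0)"
  by (simp add: mvar_def)

lemma coeff_of_mvar_power:
  fixes z :: 'x
  shows "coeff_of (mvar z ^ n :: ('x, 'a::comm_ring_1) mseries) m
    = (if m = replicate_mset n z then 1 else 0)"
proof (induction n arbitrary: m)
  case 0
  show ?case by (simp add: coeff_of_1)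
next
  case (Suc n)
  let ?t = "\<lambda>(a, b). coeff_of (mvar z :: ('x, 'a) mseries) a
    * coeff_of (mvar z ^ n :: ('x, 'a) mseries) b"
  let ?p = "({#z#}, replicate_mset n z)"
  have z: "?t p = 0" if "p \<noteq> ?p" for p
    using that by (cases p) (auto simp: Suc.IH coeff_of_mvar)
  have "sum ?t (splits m) = sum ?t (splits m \<inter> {?p})"
    using z by (intro sum.mono_neutral_right) auto
  also have "\<dots> = (if m = replicate_mset (Suc n) z then 1 else 0)"
    by (auto simp: splits_def Suc.IH coeff_of_mvar)
  finally show ?case
    by (simp add: coeff_of_mult)
qed

lemma formally_summable_mvar_power:
  assumes "n \<ge> 1"
  shows "formally_summable (\<lambda>i. mvar (X i) ^ n :: (base_var, 'a::comm_ring_1) mseries) A"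
proof -
  have "{i \<in> A. coeff_of (mvar (X i) ^ n :: (base_var, 'a) mseries) m \<noteq> 0} \<subseteq> X -` set_mset m" for m
    using assms by (auto simp: coeff_of_mvar_power)
  moreover have "finite (X -` set_mset m)" for m :: "base_var multiset"
    by (intro finite_vimageI) (simp_all add: inj_def)
  ultimately show ?thesis
    unfolding formally_summable_def by (blast intro: finite_subset)
qed

lemma coeff_of_power_sum:
  assumes "n \<ge> 1"
  shows "coeff_of (power_sum n) m = (if \<exists>i\<ge>1. m = replicate_mset n (X i) then 1 else 0)"
proof -
  have inj: "i = j" if "replicate_mset n (X i) = replicate_mset n (X j)" for i j
    using arg_cong[OF that, of set_mset] assms by (simp split: if_splits)
  show ?thesis
  proof (cases "\<exists>i\<ge>1. m = replicate_mset n (X i)")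
    case True
    then obtain i where i: "i \<ge> 1" "m = replicate_mset n (X i)"
      by blast
    then have "coeff_of (power_sum n) m
        = (\<Sum>j\<in>{i}. coeff_of (mvar (X j) ^ n :: series) m)"
      unfolding power_sum_def using inj
      by (intro coeff_of_formal_sum_eq) (auto simp: coeff_of_mvar_power)
    with i show ?thesis
      by (auto simp: coeff_of_mvar_power)
  next
    case False
    then have "coeff_of (power_sum n) m
        = (\<Sum>j\<in>{}. coeff_of (mvar (X j) ^ n :: series) m)"
      unfolding power_sum_def
      by (intro coeff_of_formal_sum_eq) (auto simp: coeff_of_mvar_power)
    with False show ?thesis
      by auto
  qed
qed

section \<open>Exponents of the monomials in a product of power sums\<close>

definition exponents :: "'x multiset \<Rightarrow> nat multiset" where
  "exponents m = image_mset (count m) (mset_set (set_mset m))"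

lemma size_exponents: "size (exponents m) = card (set_mset m)"
  by (simp add: exponents_def)

lemma exponents_replicate_add:
  assumes "n \<ge> 1" "x \<notin># b"
  shows "exponents (replicate_mset n x + b) = add_mset n (exponents b)"
proof -
  have "set_mset (replicate_mset n x + b) = insert x (set_mset b)"
    using assms by auto
  moreover have "image_mset (count (replicate_mset n x + b)) (mset_set (set_mset b))
      = image_mset (count b) (mset_set (set_mset b))"
    using assms by (intro image_mset_cong) (auto)
  moreover have "count b x = 0"
    using assms by (simp add: not_in_iff)
  ultimately show ?thesis
    using assms by (simp add: exponents_def)
qed

abbreviation power_sum_prod :: "nat multiset \<Rightarrow> series" where
  "power_sum_prod \<mu> \<equiv> \<Prod>n\<in>#\<mu>. power_sum n"

text \<open>Each factor supplies a power of a single variable, so there are at most as many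
  variables as factors. Equality forces the factors to use different variables, and then the
  exponents are the indices of the power sums. The index 0 is kept out because the family defining
  \<open>power_sum 0\<close> is not summable.\<close>

lemma coeff_of_power_sum_prod_nonzero:
  assumes "0 \<notin># \<mu>" "coeff_of (power_sum_prod \<mu>) m \<noteq> 0"
  shows "card (set_mset m) \<le> size \<mu>"
    and "card (set_mset m) = size \<mu> \<Longrightarrow> exponents m = \<mu>"
proof -
  have "card (set_mset m) \<le> size \<mu> \<and> (card (set_mset m) = size \<mu> \<longrightarrow> exponents m = \<mu>)"
    using assms
  proof (induction \<mu> arbitrary: m)
    case empty
    then show ?case
      by (auto simp: coeff_of_1 exponents_def split: if_splits)
  next
    case (add n \<mu>)
    then have n: "n \<ge> 1"
      by (simp add: Suc_le_eq)
    have "\<exists>ab\<in>splits m. coeff_of (power_sum n) (fst ab) * coeff_of (power_sum_prod \<mu>) (snd ab) \<noteq> 0"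
      using add.prems(2) unfolding image_mset_add_mset prod_mset.add_mset coeff_of_mult
        case_prod_beta by (meson sum.neutral)
    then obtain a b where m: "m = a + b" and a: "coeff_of (power_sum n) a \<noteq> 0"
      and b: "coeff_of (power_sum_prod \<mu>) b \<noteq> 0"
      by (auto simp: splits_def)
    from a n obtain i where i: "a = replicate_mset n (X i)"
      by (auto simp: coeff_of_power_sum split: if_splits)
    have IH: "card (set_mset b) \<le> size \<mu>" "card (set_mset b) = size \<mu> \<longrightarrow> exponents b = \<mu>"
      using add.IH[of b] add.prems(1) b by auto
    show ?case
    proof (cases "X i \<in># b")
      case True
      then have "set_mset m = set_mset b"
        using n by (auto simp: m i split: if_splits)
      then show ?thesis
        using IH by simp
    next
      case False
      moreover have "set_mset m = insert (X i) (set_mset b)"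
        using n by (auto simp: m i)
      ultimately have "card (set_mset m) = Suc (card (set_mset b))"
        by simp
      then show ?thesis
        using IH exponents_replicate_add[OF n False] by (simp add: m i)
    qed
  qed
  then show "card (set_mset m) \<le> size \<mu>" "card (set_mset m) = size \<mu> \<Longrightarrow> exponents m = \<mu>"
    by auto
qed

lemma sum_in_Nats: "(\<And>i. i \<in> A \<Longrightarrow> h i \<in> \<nat>) \<Longrightarrow> sum h A \<in> \<nat>"
  by (induction A rule: infinite_finite_induct) auto

text \<open>Natural numbers as coefficients rule out cancellation: a single way of producing a
  monomial suffices to make its coefficient nonzero.\<close>

lemma coeff_of_power_sum_prod_Nats:
  assumes "0 \<notin># \<mu>"
  shows "coeff_of (power_sum_prod \<mu>) m \<in> \<nat>"
  using assms
proof (induction \<mu> arbitrary: m)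
  case empty
  show ?case by (auto simp: coeff_of_1)
next
  case (add n \<mu>)
  then show ?case
    by (auto simp: coeff_of_mult coeff_of_power_sum Suc_le_eq intro!: sum_in_Nats)
qed

lemma Nats_sum_nonzero:
  fixes h :: "'i \<Rightarrow> 'a::semiring_char_0"
  assumes "finite A" "\<And>i. i \<in> A \<Longrightarrow> h i \<in> \<nat>" "j \<in> A" "h j \<noteq> 0"
  shows "sum h A \<noteq> 0"
proof -
  obtain k where k: "\<And>i. i \<in> A \<Longrightarrow> h i = of_nat (k i)"
    using assms(2) unfolding Nats_def image_iff by metis
  then have "sum h A = of_nat (sum k A)"
    by simp
  moreover have "k j \<noteq> 0"
    using k[of j] assms(3,4) by auto
  ultimately show ?thesis
    using assms(1,3) by (auto simp flip: of_nat_sum)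
qed

lemma coeff_of_power_sum_prod_exponents:
  assumes "0 \<notin># \<mu>"
  shows "\<exists>m. exponents m = \<mu> \<and> coeff_of (power_sum_prod \<mu>) m \<noteq> 0"
  using assms
proof (induction \<mu>)
  case empty
  show ?case
    by (intro exI[of _ "{#}"]) (simp add: coeff_of_1 exponents_def)
next
  case (add n \<mu>)
  then have n: "n \<ge> 1"
    by (simp add: Suc_le_eq)
  from add obtain b where b: "exponents b = \<mu>" "coeff_of (power_sum_prod \<mu>) b \<noteq> 0"
    by auto
  \<comment> \<open>The new factor must use a variable absent from \<open>b\<close>, so that its
    exponent is recorded separately; 0 is avoided as well because \<open>power_sum\<close> starts at
    index 1.\<close>
  have "finite (insert 0 (X -` set_mset b))"
    by (intro finite.insertI finite_vimageI) (simp_all add: inj_def)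
  then obtain i where "i \<notin> insert 0 (X -` set_mset b)"
    using ex_new_if_finite infinite_UNIV_nat by blast
  then have i: "i \<ge> 1" "X i \<notin># b"
    by auto
  let ?a = "replicate_mset n (X i)"
  have "coeff_of (power_sum_prod (add_mset n \<mu>)) (?a + b) \<noteq> 0"
    unfolding image_mset_add_mset prod_mset.add_mset coeff_of_mult
  proof (rule Nats_sum_nonzero)
    show "(?a, b) \<in> splits (?a + b)"
      by (simp add: splits_def)
    show "(case (?a, b) of (a, b) \<Rightarrow> coeff_of (power_sum n) a * coeff_of (power_sum_prod \<mu>) b) \<noteq> 0"
      using b i n by (auto simp: coeff_of_power_sum)
    show "(case p of (a, b) \<Rightarrow> coeff_of (power_sum n) a * coeff_of (power_sum_prod \<mu>) b) \<in> \<nat>" for p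
      using n add.prems
      by (auto simp: coeff_of_power_sum coeff_of_power_sum_prod_Nats case_prod_beta)
  qed simp
  with exponents_replicate_add[OF n i(2)] b(1) show ?case
    by metis
qed

text \<open>
  Among the products that occur, one with the largest number of factors contributes a monomial
  that no other product contains.
\<close>

lemma power_sum_prod_independent:
  assumes "finite L" "\<And>\<mu>. \<mu> \<in> L \<Longrightarrow> 0 \<notin># \<mu>"
    and zero: "(\<Sum>\<mu>\<in>L. mconst (c \<mu>) * power_sum_prod \<mu>) = 0"
    and "\<mu> \<in> L"
  shows "c \<mu> = 0"
proof (rule ccontr)
  assume "c \<mu> \<noteq> 0"
  let ?N = "{\<mu> \<in> L. c \<mu> \<noteq> 0}"
  have N: "finite ?N" "?N \<noteq> {}"
    using assms \<open>c \<mu> \<noteq> 0\<close> by auto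
  have "Max (size ` ?N) \<in> size ` ?N"
    using N by (intro Max_in) auto
  then obtain \<nu> where "\<nu> \<in> ?N" "size \<nu> = Max (size ` ?N)"
    by auto
  then have \<nu>: "\<nu> \<in> L" "c \<nu> \<noteq> 0" and max: "\<And>\<mu>. \<mu> \<in> L \<Longrightarrow> c \<mu> \<noteq> 0 \<Longrightarrow> size \<mu> \<le> size \<nu>"
    using N(1) by auto
  obtain m where m: "exponents m = \<nu>" "coeff_of (power_sum_prod \<nu>) m \<noteq> 0"
    using coeff_of_power_sum_prod_exponents assms(2) \<nu>(1) by blast
  have "c \<mu> * coeff_of (power_sum_prod \<mu>) m = 0" if "\<mu> \<in> L - {\<nu>}" for \<mu>
  proof (rule ccontr)
    assume "\<not> ?thesis"
    then have "c \<mu> \<noteq> 0" and nz: "coeff_of (power_sum_prod \<mu>) m \<noteq> 0"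
      by auto
    then have "size \<mu> \<le> card (set_mset m)"
      using max[of \<mu>] that m(1) by (simp flip: size_exponents)
    then have "exponents m = \<mu>"
      using coeff_of_power_sum_prod_nonzero[OF _ nz] that assms(2) by auto
    with m(1) that show False
      by simp
  qed
  then have "(\<Sum>\<mu>\<in>L. c \<mu> * coeff_of (power_sum_prod \<mu>) m)
      = (\<Sum>\<mu>\<in>{\<nu>}. c \<mu> * coeff_of (power_sum_prod \<mu>) m)"
    using assms(1) \<nu>(1) by (intro sum.mono_neutral_right) auto
  moreover have "(\<Sum>\<mu>\<in>L. c \<mu> * coeff_of (power_sum_prod \<mu>) m) = 0"
    using arg_cong[OF zero, of "\<lambda>F. coeff_of F m"] by simp
  ultimately show False
    using \<nu>(2) m(2) by simp
qed

section \<open>Polynomials in the power sums and uniqueness of plethysm\<close>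

definition lin_comb :: "(nat \<Rightarrow> series) \<Rightarrow> (complex poly \<times> nat multiset) list \<Rightarrow> series" where
  "lin_comb p xs = (\<Sum>(c, \<mu>)\<leftarrow>xs. mconst c * (\<Prod>n\<in>#\<mu>. p n))"

text \<open>A list may repeat an index multiset, whereas independence speaks of distinct products;
  collecting the terms connects the two.\<close>

lemma lin_comb_collect:
  assumes "finite L" "snd ` set xs \<subseteq> L"
  shows "lin_comb p xs
    = (\<Sum>\<mu>\<in>L. mconst (\<Sum>(c, \<nu>)\<leftarrow>xs. if \<nu> = \<mu> then c else 0) * (\<Prod>n\<in>#\<mu>. p n))"
  using assms(2)
proof (induction xs)
  case Nil
  show ?case by (simp add: lin_comb_def)
next
  case (Cons x xs)
  obtain c \<nu> where x: "x = (c, \<nu>)"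
    by (cases x)
  have "(\<Sum>\<mu>\<in>L. mconst (if \<nu> = \<mu> then c else 0) * (\<Prod>n\<in>#\<mu>. p n))
      = (\<Sum>\<mu>\<in>L. if \<nu> = \<mu> then mconst c * (\<Prod>n\<in>#\<mu>. p n) else 0)"
    by (intro sum.cong) auto
  also have "\<dots> = mconst c * (\<Prod>n\<in>#\<nu>. p n)"
    using assms(1) Cons.prems x by (simp add: sum.delta')
  finally have new: "(\<Sum>\<mu>\<in>L. mconst (if \<nu> = \<mu> then c else 0) * (\<Prod>n\<in>#\<mu>. p n))
    = mconst c * (\<Prod>n\<in>#\<nu>. p n)" .
  have "lin_comb p (x # xs) = mconst c * (\<Prod>n\<in>#\<nu>. p n) + lin_comb p xs"
    by (simp add: lin_comb_def x)
  also have "\<dots> = (\<Sum>\<mu>\<in>L. mconst (\<Sum>(c, \<nu>)\<leftarrow>x # xs. if \<nu> = \<mu> then c else 0) * (\<Prod>n\<in>#\<mu>. p n))"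
    using Cons by (simp add: x mconst_add distrib_right sum.distrib flip: new)
  finally show ?case .
qed

text \<open>Independence makes all collected coefficients vanish, and they do not depend on
  \<open>p\<close>. So a relation that holds for the power sums holds for any family substituted for
  them.\<close>

lemma lin_comb_power_sum_eq_0:
  assumes "\<forall>x\<in>set xs. 0 \<notin># snd x" "lin_comb power_sum xs = 0"
  shows "lin_comb p xs = 0"
proof -
  let ?c = "\<lambda>\<mu>. \<Sum>(c, \<nu>)\<leftarrow>xs. if \<nu> = \<mu> then c else 0"
  have zero: "(\<Sum>\<mu>\<in>snd ` set xs. mconst (?c \<mu>) * power_sum_prod \<mu>) = 0"
    using lin_comb_collect[of "snd ` set xs" xs power_sum] assms(2) by simp
  have "?c \<mu> = 0" if "\<mu> \<in> snd ` set xs" for \<mu>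
    by (rule power_sum_prod_independent[OF _ _ zero that]) (use assms(1) in auto)
  then show ?thesis
    by (subst lin_comb_collect[of "snd ` set xs"]) auto
qed

lemma lin_comb_append: "lin_comb p (xs @ ys) = lin_comb p xs + lin_comb p ys"
  by (simp add: lin_comb_def)

lemma lin_comb_uminus: "lin_comb p (map (\<lambda>(c, \<mu>). (- c, \<mu>)) xs) = - lin_comb p xs"
  by (induction xs) (auto simp: lin_comb_def mconst_uminus)

lemma lin_comb_product:
  "lin_comb p (concat (map (\<lambda>(c, \<mu>). map (\<lambda>(d, \<nu>). (c * d, \<mu> + \<nu>)) ys) xs))
     = lin_comb p xs * lin_comb p ys"
proof (induction xs)
  case Nil
  show ?case by (simp add: lin_comb_def)
next
  case (Cons x xs)
  obtain c \<mu> where x: "x = (c, \<mu>)"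
    by (cases x)
  have "lin_comb p (map (\<lambda>(d, \<nu>). (c * d, \<mu> + \<nu>)) ys) = mconst c * (\<Prod>n\<in>#\<mu>. p n) * lin_comb p ys"
    by (induction ys) (auto simp: lin_comb_def mconst_mult algebra_simps)
  moreover have "lin_comb p (x # xs) = mconst c * (\<Prod>n\<in>#\<mu>. p n) + lin_comb p xs"
    by (simp add: lin_comb_def x)
  ultimately show ?case
    using Cons by (simp add: x lin_comb_append algebra_simps)
qed

text \<open>A derivation of \<open>plethysm_rel\<close> is a polynomial expression evaluated at two
  families at once. Extracting its list of terms turns uniqueness into a statement about one list
  under two evaluations; sums become concatenations, so no normal form has to be maintained.\<close>

lemma plethysm_rel_lin_comb:
  assumes "plethysm_rel f F R"
  shows "\<exists>xs. (\<forall>x\<in>set xs. 0 \<notin># snd x) \<and> F = lin_comb power_sum xs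
    \<and> R = lin_comb (\<lambda>n. power_sum_of n f) xs"
  using assms
proof (induction rule: plethysm_rel.induct)
  case (const c)
  show ?case
    by (rule exI[of _ "[(c, {#})]"]) (simp add: lin_comb_def)
next
  case (power_sum n)
  then show ?case
    by (intro exI[of _ "[(1, {#n#})]"]) (simp add: lin_comb_def)
next
  case (add F R G S)
  then obtain xs ys where "\<forall>x\<in>set xs. 0 \<notin># snd x" "\<forall>x\<in>set ys. 0 \<notin># snd x"
    "F = lin_comb power_sum xs" "R = lin_comb (\<lambda>n. power_sum_of n f) xs"
    "G = lin_comb power_sum ys" "S = lin_comb (\<lambda>n. power_sum_of n f) ys"
    by auto
  then show ?case
    by (intro exI[of _ "xs @ ys"]) (auto simp: lin_comb_append)
next
  case (mult F R G S)
  then obtain xs ys where xs: "\<forall>x\<in>set xs. 0 \<notin># snd x" "\<forall>x\<in>set ys. 0 \<notin># snd x"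
    "F = lin_comb power_sum xs" "R = lin_comb (\<lambda>n. power_sum_of n f) xs"
    "G = lin_comb power_sum ys" "S = lin_comb (\<lambda>n. power_sum_of n f) ys"
    by auto
  show ?case
    by (rule exI[of _ "concat (map (\<lambda>(c, \<mu>). map (\<lambda>(d, \<nu>). (c * d, \<mu> + \<nu>)) ys) xs)"])
      (use xs in \<open>fastforce simp: lin_comb_product\<close>)
qed

text \<open>The formal difference of the two lists evaluates to \<open>F - F = 0\<close> at the
  power sums, hence to 0 at the substituted family, where its value is \<open>R - S\<close>.\<close>

lemma plethysm_rel_unique:
  assumes "plethysm_rel f F R" "plethysm_rel f F S"
  shows "R = S"
proof -
  obtain xs ys where xs: "\<forall>x\<in>set xs. 0 \<notin># snd x" "F = lin_comb power_sum xs"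
      "R = lin_comb (\<lambda>n. power_sum_of n f) xs"
    and ys: "\<forall>x\<in>set ys. 0 \<notin># snd x" "F = lin_comb power_sum ys"
      "S = lin_comb (\<lambda>n. power_sum_of n f) ys"
    using assms[THEN plethysm_rel_lin_comb] by auto
  let ?zs = "xs @ map (\<lambda>(c, \<mu>). (- c, \<mu>)) ys"
  have zs: "lin_comb p ?zs = lin_comb p xs - lin_comb p ys" for p
    by (simp add: lin_comb_append lin_comb_uminus)
  have "\<forall>x\<in>set ?zs. 0 \<notin># snd x"
    using xs(1) ys(1) by (auto simp: case_prod_beta)
  moreover have "lin_comb power_sum ?zs = 0"
    unfolding zs using xs(2) ys(2) by simp
  ultimately have "lin_comb (\<lambda>n. power_sum_of n f) ?zs = 0"
    by (rule lin_comb_power_sum_eq_0)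
  then show ?thesis
    by (simp add: zs xs ys)
qed

lemma plethysm_eqI: "plethysm_rel f F R \<Longrightarrow> plethysm F f = R"
  unfolding plethysm_def by (blast intro: plethysm_rel_unique)

lemma plethysm_rel_sum:
  assumes "\<And>i. i \<in> A \<Longrightarrow> plethysm_rel f (F i) (R i)"
  shows "plethysm_rel f (sum F A) (sum R A)"
  using assms plethysm_rel.const[of f 0]
  by (induction A rule: infinite_finite_induct) (auto intro: plethysm_rel.add)

lemma plethysm_rel_prod:
  assumes "\<And>i. i \<in> A \<Longrightarrow> plethysm_rel f (F i) (R i)"
  shows "plethysm_rel f (prod F A) (prod R A)"
  using assms plethysm_rel.const[of f 1]
  by (induction A rule: infinite_finite_induct) (auto intro: plethysm_rel.mult)

section \<open>Deletion and contraction for acyclic biorientations\<close>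

definition comps :: "'v set \<Rightarrow> 'v rel \<Rightarrow> nat" where
  "comps V R = card (V // {(u, v) \<in> V \<times> V. (u, v) \<in> R\<^sup>*})"

abbreviation link :: "'v \<Rightarrow> 'v \<Rightarrow> 'v rel \<Rightarrow> 'v rel" where
  "link u v R \<equiv> insert (u, v) (insert (v, u) R)"

lemma sym_link: "sym R \<Longrightarrow> sym (link u v R)"
  by (auto simp: sym_def)

lemma rtrancl_link:
  "(link u v R)\<^sup>* = R\<^sup>* \<union> {(x, y). (x, u) \<in> R\<^sup>* \<and> (v, y) \<in> R\<^sup>*}
     \<union> {(x, y). (x, v) \<in> R\<^sup>* \<and> (u, y) \<in> R\<^sup>*}
     \<union> {(x, y). (x, u) \<in> R\<^sup>* \<and> (u, y) \<in> R\<^sup>*} \<union> {(x, y). (x, v) \<in> R\<^sup>* \<and> (v, y) \<in> R\<^sup>*}"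
  unfolding rtrancl_insert by (auto intro: rtrancl_trans)

lemma rtrancl_link_connected:
  assumes "(u, v) \<in> R\<^sup>*" "(v, u) \<in> R\<^sup>*"
  shows "(link u v R)\<^sup>* = R\<^sup>*"
  unfolding rtrancl_link using assms by (auto intro: rtrancl_trans)

lemma equiv_connected:
  assumes "sym R"
  shows "equiv V {(u, v) \<in> V \<times> V. (u, v) \<in> R\<^sup>*}"
proof (rule equivI)
  show "sym {(u, v) \<in> V \<times> V. (u, v) \<in> R\<^sup>*}"
    using sym_rtrancl[OF assms] by (auto simp: sym_def)
qed (auto simp: refl_on_def trans_def intro: rtrancl_trans)

text \<open>The classes of \<open>u\<close> and \<open>v\<close>, distinct by \<open>uv\<close>,
  give way to their union \<open>?W\<close>, and every other class survives, so the quotient loses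
  exactly one element. This is the source of the sign change under contraction.\<close>

lemma comps_link:
  assumes "finite V" "u \<in> V" "v \<in> V" "sym R" and uv: "(u, v) \<notin> R\<^sup>*"
  shows "comps V R = Suc (comps V (link u v R))"
proof -
  define E where "E = {(u, v) \<in> V \<times> V. (u, v) \<in> R\<^sup>*}"
  define E' where "E' = {(x, y) \<in> V \<times> V. (x, y) \<in> (link u v R)\<^sup>*}"
  have symR: "(y, x) \<in> R\<^sup>*" if "(x, y) \<in> R\<^sup>*" for x y
    using sym_rtrancl[OF \<open>sym R\<close>] that by (auto dest: symD)
  have E: "equiv V E"
    unfolding E_def using \<open>sym R\<close> by (rule equiv_connected)
  let ?W = "E `` {u} \<union> E `` {v}"
  have merged: "E' `` {x} = ?W" if "x \<in> ?W" for x
    using that symR \<open>u \<in> V\<close> \<open>v \<in> V\<close> unfolding E_def E'_def rtrancl_link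
    by (auto intro: rtrancl_trans)
  have kept: "E' `` {x} = E `` {x}" if "x \<in> V" "x \<notin> ?W" for x
    using that symR \<open>u \<in> V\<close> \<open>v \<in> V\<close> unfolding E_def E'_def rtrancl_link
    by auto
  have uW: "u \<in> ?W" and u: "u \<in> E `` {u}" and v: "v \<in> E `` {v}"
    using \<open>u \<in> V\<close> \<open>v \<in> V\<close> by (auto simp: E_def)
  have quot: "V // E' = insert ?W (V // E - {E `` {u}, E `` {v}})"
  proof (intro equalityI subsetI)
    fix C assume "C \<in> V // E'"
    then obtain x where x: "x \<in> V" "C = E' `` {x}"
      by (auto elim: quotientE)
    show "C \<in> insert ?W (V // E - {E `` {u}, E `` {v}})"
    proof (cases "x \<in> ?W")
      case True
      with x merged show ?thesis by simp
    next
      case False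
      moreover have "x \<in> E `` {x}"
        using x by (simp add: E_def)
      ultimately show ?thesis
        using x kept by (auto intro: quotientI)
    qed
  next
    fix C assume "C \<in> insert ?W (V // E - {E `` {u}, E `` {v}})"
    then consider "C = ?W" | "C \<in> V // E" "C \<noteq> E `` {u}" "C \<noteq> E `` {v}"
      by blast
    then show "C \<in> V // E'"
    proof cases
      case 1
      then show ?thesis
        using merged[OF uW] \<open>u \<in> V\<close> by (metis quotientI)
    next
      case 2
      then obtain x where x: "x \<in> V" "C = E `` {x}"
        by (auto elim: quotientE)
      then have "x \<notin> ?W"
        using 2 equiv_class_eq[OF E] by (metis Image_singleton_iff UnE)
      then show ?thesis
        using x kept by (metis quotientI)
    qed
  qed
  have notin: "?W \<notin> V // E - {E `` {u}, E `` {v}}"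
  proof
    assume W: "?W \<in> V // E - {E `` {u}, E `` {v}}"
    then have "?W \<in> V // E"
      by blast
    then obtain x where "?W = E `` {x}"
      by (rule quotientE)
    with uW show False
      using W equiv_class_eq[OF E] by (metis DiffE Image_singleton_iff insertI1)
  qed
  have ne: "E `` {u} \<noteq> E `` {v}"
    using uv v by (auto simp: E_def)
  have mem: "E `` {u} \<in> V // E" "E `` {v} \<in> V // E"
    using \<open>u \<in> V\<close> \<open>v \<in> V\<close> by (auto intro: quotientI)
  have fin: "finite (V // E)"
    using \<open>finite V\<close> by (auto simp: quotient_def)
  have "card (V // E) = Suc (card (V // E - {E `` {u}}))"
    using fin mem(1) by (rule card.remove)
  also have "card (V // E - {E `` {u}}) = Suc (card (V // E - {E `` {u}} - {E `` {v}}))"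
    using fin mem(2) ne by (intro card.remove) auto
  also have "V // E - {E `` {u}} - {E `` {v}} = V // E - {E `` {u}, E `` {v}}"
    by auto
  finally have "card (V // E) = Suc (Suc (card (V // E - {E `` {u}, E `` {v}})))" .
  moreover have "card (V // E') = Suc (card (V // E - {E `` {u}, E `` {v}}))"
    unfolding quot using notin fin by simp
  ultimately show ?thesis
    by (simp add: comps_def E_def E'_def)
qed

text \<open>\<open>S\<close> holds the single arcs, and \<open>B\<close> the bidirected and the
  contracted edges. Cycles inside \<open>B\<close> are allowed; only an arc of \<open>S\<close> with
  a return walk is forbidden.\<close>

definition acyclic_over :: "'v rel \<Rightarrow> 'v rel \<Rightarrow> bool" where
  "acyclic_over B S \<longleftrightarrow> (\<forall>(a, b)\<in>S. (b, a) \<notin> (B \<union> S)\<^sup>*)"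

lemma rtrancl_Un_cases:
  assumes "(x, y) \<in> (B \<union> S)\<^sup>*"
  shows "(x, y) \<in> B\<^sup>* \<or> (\<exists>(a, b)\<in>S. (x, a) \<in> (B \<union> S)\<^sup>* \<and> (b, y) \<in> (B \<union> S)\<^sup>*)"
  using assms
proof (induction rule: rtrancl_induct)
  case (step y z)
  then show ?case
    by (fastforce intro: rtrancl_into_rtrancl)
qed simp

text \<open>A closed walk that appears only with the new arc runs through it, and the rest of that
  walk leads from \<open>v\<close> to \<open>u\<close>. So the new arc alone has to be
  tested.\<close>

lemma acyclic_over_insert:
  "acyclic_over B (insert (u, v) S) \<longleftrightarrow> acyclic_over B S \<and> (v, u) \<notin> (B \<union> S)\<^sup>*"
proof -
  have eq: "(B \<union> insert (u, v) S)\<^sup>* = (B \<union> S)\<^sup>* \<union> {(x, y). (x, u) \<in> (B \<union> S)\<^sup>* \<and> (v, y) \<in> (B \<union> S)\<^sup>*}"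
    using rtrancl_insert[of u v "B \<union> S"] by simp
  have "(v, u) \<in> (B \<union> S)\<^sup>*" if "(a, b) \<in> S" "(b, u) \<in> (B \<union> S)\<^sup>*" "(v, a) \<in> (B \<union> S)\<^sup>*" for a b
    using that by (meson UnI2 converse_rtrancl_into_rtrancl rtrancl_trans)
  then show ?thesis
    unfolding acyclic_over_def eq by blast
qed

lemma acyclic_over_link_connected:
  assumes "(u, v) \<in> B\<^sup>*" "(v, u) \<in> B\<^sup>*"
  shows "acyclic_over (link u v B) S \<longleftrightarrow> acyclic_over B S"
proof -
  have "(u, v) \<in> (B \<union> S)\<^sup>*" "(v, u) \<in> (B \<union> S)\<^sup>*"
    using assms by (meson in_mono rtrancl_mono sup_ge1)+
  then have "(link u v (B \<union> S))\<^sup>* = (B \<union> S)\<^sup>*"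
    by (rule rtrancl_link_connected)
  then show ?thesis
    by (simp add: acyclic_over_def)
qed

text \<open>A walk from \<open>u\<close> to \<open>v\<close> that \<open>B\<close> alone cannot
  provide crosses an arc of \<open>S\<close>, and a return walk would close a cycle through that
  arc. Hence at most one of the two single directions of an edge between \<open>u\<close> and
  \<open>v\<close> is blocked.\<close>

lemma acyclic_over_not_connected:
  assumes "acyclic_over B S" "(u, v) \<notin> B\<^sup>*" "(u, v) \<in> (B \<union> S)\<^sup>*"
  shows "(v, u) \<notin> (B \<union> S)\<^sup>*"
proof
  assume vu: "(v, u) \<in> (B \<union> S)\<^sup>*"
  from assms(2,3) obtain a b where "(a, b) \<in> S" "(u, a) \<in> (B \<union> S)\<^sup>*" "(b, v) \<in> (B \<union> S)\<^sup>*"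
    using rtrancl_Un_cases by fast
  with vu assms(1) show False
    unfolding acyclic_over_def by (fastforce intro: rtrancl_trans)
qed

text \<open>Identifying \<open>u\<close> and \<open>v\<close> closes any walk between them, and such
  a walk contains an arc of \<open>S\<close> because \<open>B\<close> does not connect them.
  Conversely, a new closed walk through an arc of \<open>S\<close> crosses the link, and its
  remainder runs between \<open>u\<close> and \<open>v\<close>. So contraction preserves acyclicity
  exactly when neither single direction is blocked.\<close>

lemma acyclic_over_link:
  assumes "sym B" "(u, v) \<notin> B\<^sup>*"
  shows "acyclic_over (link u v B) S
    \<longleftrightarrow> acyclic_over B S \<and> (u, v) \<notin> (B \<union> S)\<^sup>* \<and> (v, u) \<notin> (B \<union> S)\<^sup>*"
proof -
  have vu: "(v, u) \<notin> B\<^sup>*"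
    using assms sym_rtrancl by (metis symD)
  have eq: "link u v B \<union> S = link u v (B \<union> S)"
    by simp
  show ?thesis (is "?L \<longleftrightarrow> ?R")
  proof
    assume L: ?L
    then have B: "acyclic_over B S"
      unfolding acyclic_over_def eq rtrancl_link by blast
    have "(x, y) \<notin> (B \<union> S)\<^sup>*" if "(x, y) \<notin> B\<^sup>*" "{x, y} = {u, v}" for x y
    proof
      assume "(x, y) \<in> (B \<union> S)\<^sup>*"
      with that(1) obtain a b where ab: "(a, b) \<in> S" "(x, a) \<in> (B \<union> S)\<^sup>*" "(b, y) \<in> (B \<union> S)\<^sup>*"
        using rtrancl_Un_cases by fast
      with that(2) have "(b, a) \<in> (link u v (B \<union> S))\<^sup>*"
        unfolding rtrancl_link by (auto simp: doubleton_eq_iff)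
      with L ab(1) show False
        unfolding acyclic_over_def eq by blast
    qed
    with B vu assms(2) show ?R
      by (metis insert_commute)
  next
    assume R: ?R
    have "(b, a) \<notin> (link u v (B \<union> S))\<^sup>*" if "(a, b) \<in> S" for a b
    proof
      have ab: "(a, b) \<in> (B \<union> S)\<^sup>*"
        using that by blast
      assume "(b, a) \<in> (link u v (B \<union> S))\<^sup>*"
      moreover have "(b, a) \<notin> (B \<union> S)\<^sup>*"
        using R that by (auto simp: acyclic_over_def)
      ultimately show False
        using R ab unfolding rtrancl_link by (auto dest: rtrancl_trans)
    qed
    then show ?L
      unfolding acyclic_over_def eq by blast
  qed
qed

section \<open>Signed weights of partial orientations\<close>

definition dirs :: "('e \<Rightarrow> 'v uprod) \<Rightarrow> 'e \<Rightarrow> 'v direction set" where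
  "dirs en e = insert Bidirected {Single u v | u v. en e = Upair u v}"

definition edge_rel :: "('e \<Rightarrow> 'v uprod) \<Rightarrow> 'e set \<Rightarrow> 'v rel" where
  "edge_rel en S = {(a, b). \<exists>e\<in>S. en e = Upair a b}"

definition bidir :: "'e set \<Rightarrow> ('e \<Rightarrow> 'v direction) \<Rightarrow> 'e set" where
  "bidir D \<gamma> = {e \<in> D. \<gamma> e = Bidirected}"

definition arcs :: "'e set \<Rightarrow> ('e \<Rightarrow> 'v direction) \<Rightarrow> 'v rel" where
  "arcs D \<gamma> = {(a, b). \<exists>e\<in>D. \<gamma> e = Single a b}"

lemma dirs_Upair: "en e = Upair u v \<Longrightarrow> dirs en e = {Bidirected, Single u v, Single v u}"
  by (auto simp: dirs_def)

lemma finite_dirs [simp]: "finite (dirs en e)"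
proof -
  obtain u v where e: "en e = Upair u v"
    by (cases "en e")
  show ?thesis
    unfolding dirs_Upair[of en e, OF e] by simp
qed

lemma sym_edge_rel: "sym (edge_rel en S)"
  by (auto simp: sym_def edge_rel_def) (metis Upair_inject)

lemma edge_rel_insert:
  "en e = Upair u v \<Longrightarrow> edge_rel en (insert e S) = link u v (edge_rel en S)"
  by (auto simp: edge_rel_def)

text \<open>Orientations with a forbidden cycle get weight 0 instead of being excluded, so that sums
  range over a full product of \<open>dirs\<close> and can be split one edge at a time.\<close>

definition weighted_orientation ::
  "'a::comm_ring_1 \<Rightarrow> 'v set \<Rightarrow> ('e \<Rightarrow> 'v uprod) \<Rightarrow> 'e set \<Rightarrow> 'v rel \<Rightarrow> ('e \<Rightarrow> 'v direction) \<Rightarrow> 'a" where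
  "weighted_orientation t V en D B \<gamma> =
    (if acyclic_over (B \<union> edge_rel en (bidir D \<gamma>)) (arcs D \<gamma>)
     then (1 + t) ^ card (bidir D \<gamma>) * (- 1) ^ comps V (B \<union> edge_rel en (bidir D \<gamma>)) else 0)"

lemma arcs_insert_upd:
  assumes "e \<notin> D"
  shows "arcs (insert e D) (\<gamma>(e := d)) = {(a, b). d = Single a b} \<union> arcs D \<gamma>"
proof -
  have "(\<exists>e'\<in>D. (\<gamma>(e := d)) e' = x) \<longleftrightarrow> (\<exists>e'\<in>D. \<gamma> e' = x)" for x
    using assms by (intro bex_cong) auto
  then show ?thesis
    by (auto simp: arcs_def simp del: fun_upd_apply) auto
qed

text \<open>For walks and components a bidirected edge is the same as a contracted one; only its
  factor \<open>1 + t\<close> remains.\<close>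

lemma weighted_orientation_Bidirected:
  assumes "finite D" "e \<notin> D" "en e = Upair u v"
  shows "weighted_orientation t V en (insert e D) B (\<gamma>(e := Bidirected))
    = (1 + t) * weighted_orientation t V en D (link u v B) \<gamma>"
proof -
  have b: "bidir (insert e D) (\<gamma>(e := Bidirected)) = insert e (bidir D \<gamma>)"
    using assms by (auto simp: bidir_def)
  have "arcs (insert e D) (\<gamma>(e := Bidirected)) = arcs D \<gamma>"
    using assms by (auto simp: arcs_insert_upd)
  moreover have "card (insert e (bidir D \<gamma>)) = Suc (card (bidir D \<gamma>))"
    using assms by (auto simp: bidir_def)
  ultimately show ?thesis
    by (simp add: weighted_orientation_def b edge_rel_insert[of en e, OF assms(3)])
qed

lemma weighted_orientation_Single:
  assumes "e \<notin> D"
  shows "weighted_orientation t V en (insert e D) B (\<gamma>(e := Single a b))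
    = (if (b, a) \<in> (B \<union> edge_rel en (bidir D \<gamma>) \<union> arcs D \<gamma>)\<^sup>* then 0
       else weighted_orientation t V en D B \<gamma>)"
proof -
  have "bidir (insert e D) (\<gamma>(e := Single a b)) = bidir D \<gamma>"
    using assms by (auto simp: bidir_def)
  moreover have "arcs (insert e D) (\<gamma>(e := Single a b)) = insert (a, b) (arcs D \<gamma>)"
    using assms by (auto simp: arcs_insert_upd)
  ultimately show ?thesis
    by (simp add: weighted_orientation_def acyclic_over_insert)
qed

text \<open>If \<open>u\<close> and \<open>v\<close> are already joined by bidirected or contracted
  edges, both directions close a cycle and contraction changes nothing, so both sides are 0.
  Otherwise let \<open>W\<close> be the weight of an acyclic \<gamma>. If both directions are
  allowed, the contraction is acyclic with one component less and has weight \<open>- W\<close>,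
  which gives \<open>2 W = W - (- W)\<close>. If only one is allowed, the contraction has a cycle
  and \<open>W = W - 0\<close>.\<close>

lemma sum_weighted_orientation_Single:
  fixes t :: "'a::comm_ring_1"
  assumes "finite V" "u \<in> V" "v \<in> V" "sym B" "e \<notin> D" "en e = Upair u v"
  shows "(\<Sum>d\<in>{Single u v, Single v u}. weighted_orientation t V en (insert e D) B (\<gamma>(e := d)))
    = weighted_orientation t V en D B \<gamma> - weighted_orientation t V en D (link u v B) \<gamma>"
proof -
  let ?B = "B \<union> edge_rel en (bidir D \<gamma>)" and ?S = "arcs D \<gamma>"
  have symB: "sym ?B"
    using assms(4) sym_edge_rel by (rule sym_Un)
  note W = weighted_orientation_Single[OF assms(5), of t V en B \<gamma>]
  show ?thesis
  proof (cases "(u, v) \<in> ?B\<^sup>*")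
    case True
    then have vu: "(v, u) \<in> ?B\<^sup>*"
      using symB sym_rtrancl by (metis symD)
    have "?B\<^sup>* \<subseteq> (?B \<union> ?S)\<^sup>*"
      by (rule rtrancl_mono) auto
    with True vu have "(u, v) \<in> (?B \<union> ?S)\<^sup>*" "(v, u) \<in> (?B \<union> ?S)\<^sup>*"
      by auto
    then have "(\<Sum>d\<in>{Single u v, Single v u}.
        weighted_orientation t V en (insert e D) B (\<gamma>(e := d))) = 0"
      by (intro sum.neutral) (auto simp: W)
    moreover have "weighted_orientation t V en D (link u v B) \<gamma> = weighted_orientation t V en D B \<gamma>"
      using acyclic_over_link_connected[OF True vu, of ?S] rtrancl_link_connected[OF True vu]
      by (simp add: weighted_orientation_def comps_def)
    ultimately show ?thesis
      by simp
  next
    case False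
    \<comment> \<open>A loop belongs to the first case by reflexivity; here the two single
      directions are distinct summands.\<close>
    then have "u \<noteq> v"
      by auto
    have vu: "(v, u) \<notin> ?B\<^sup>*"
      using False symB sym_rtrancl by (metis symD)
    have "comps V ?B = Suc (comps V (link u v ?B))"
      using assms(1-3) symB False by (rule comps_link)
    then have sign: "(- 1 :: 'a) ^ comps V (link u v ?B) = - ((- 1) ^ comps V ?B)"
      by simp
    have two: "(\<Sum>d\<in>{Single u v, Single v u}. weighted_orientation t V en (insert e D) B (\<gamma>(e := d)))
      = (if (v, u) \<in> (?B \<union> ?S)\<^sup>* then 0 else weighted_orientation t V en D B \<gamma>)
        + (if (u, v) \<in> (?B \<union> ?S)\<^sup>* then 0 else weighted_orientation t V en D B \<gamma>)"
      using \<open>u \<noteq> v\<close> by (simp add: W)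
    show ?thesis
    proof (cases "acyclic_over ?B ?S")
      case True
      then have "\<not> ((u, v) \<in> (?B \<union> ?S)\<^sup>* \<and> (v, u) \<in> (?B \<union> ?S)\<^sup>*)"
        using acyclic_over_not_connected False by metis
      then show ?thesis
        unfolding two using True acyclic_over_link[OF symB False, of ?S] sign
        by (auto simp: weighted_orientation_def)
    next
      case not_acyclic: False
      then show ?thesis
        unfolding two using acyclic_over_link[OF symB False, of ?S]
        by (simp add: weighted_orientation_def)
    qed
  qed
qed

lemma sum_Pow_insert:
  assumes "finite A" "a \<notin> A"
  shows "sum h (Pow (insert a A)) = (\<Sum>S\<in>Pow A. h S) + (\<Sum>S\<in>Pow A. h (insert a S))"
proof -
  have "inj_on (insert a) (Pow A)"
    using assms(2) by (auto intro!: inj_onI)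
  then have "(\<Sum>S\<in>Pow A. h (insert a S)) = sum h (insert a ` Pow A)"
    by (simp add: sum.reindex)
  then show ?thesis
    unfolding Pow_insert using assms by (simp, intro sum.union_disjoint) auto
qed

lemma sum_Pow_power_card:
  fixes t :: "'a::comm_semiring_1"
  assumes "finite A"
  shows "(\<Sum>S\<in>Pow A. t ^ card S) = (1 + t) ^ card A"
  using assms
proof (induction A rule: finite_induct)
  case (insert a A)
  have "t ^ card (insert a S) = t * t ^ card S" if "S \<in> Pow A" for S
    using that insert.hyps by (subst card_insert_disjoint) (auto intro: finite_subset)
  then show ?case
    using insert by (simp add: sum_Pow_insert algebra_simps flip: sum_distrib_left)
qed simp

text \<open>
  Contracted edges are collected in the relation \<open>B\<close>.
\<close>

lemma sum_weighted_orientation: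
  assumes "finite D" "finite V" "\<And>e. e \<in> D \<Longrightarrow> set_uprod (en e) \<subseteq> V" "sym B"
  shows "(\<Sum>\<gamma>\<in>Pi\<^sub>E D (dirs en). weighted_orientation t V en D B \<gamma>)
    = (\<Sum>S\<in>Pow D. t ^ card S * (- 1) ^ comps V (B \<union> edge_rel en S))"
  using assms(1,3,4)
proof (induction D arbitrary: B rule: finite_induct)
  case empty
  show ?case
    by (simp add: weighted_orientation_def acyclic_over_def arcs_def bidir_def edge_rel_def)
next
  case (insert e D)
  obtain u v where e: "en e = Upair u v"
    by (cases "en e")
  with insert.prems(1)[of e] have uv: "u \<in> V" "v \<in> V"
    by auto
  let ?W = "weighted_orientation t V en"
  let ?T = "\<lambda>B. \<Sum>\<gamma>\<in>Pi\<^sub>E D (dirs en). ?W D B \<gamma>"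
  have "(\<Sum>\<gamma>\<in>Pi\<^sub>E (insert e D) (dirs en). ?W (insert e D) B \<gamma>)
      = (\<Sum>(d, \<gamma>)\<in>dirs en e \<times> Pi\<^sub>E D (dirs en). ?W (insert e D) B (\<gamma>(e := d)))"
    unfolding PiE_insert_eq
    by (subst sum.reindex[OF inj_combinator[OF insert.hyps(2)]]) (simp add: case_prod_beta)
  also have "\<dots> = (\<Sum>\<gamma>\<in>Pi\<^sub>E D (dirs en). \<Sum>d\<in>dirs en e. ?W (insert e D) B (\<gamma>(e := d)))"
    by (simp add: sum.cartesian_product[symmetric] sum.swap[of _ _ "dirs en e"])
  \<comment> \<open>With \<open>W\<close> the deleted and \<open>W'\<close> the contracted weight,
    \<open>(1 + t) W' + (W - W') = W + t W'\<close>: the two terms correspond to edge sets without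
    and with \<open>e\<close>.\<close>
  also have "\<dots> = (\<Sum>\<gamma>\<in>Pi\<^sub>E D (dirs en). ?W D B \<gamma> + t * ?W D (link u v B) \<gamma>)"
  proof (rule sum.cong[OF refl])
    fix \<gamma>
    have "(\<Sum>d\<in>dirs en e. ?W (insert e D) B (\<gamma>(e := d)))
        = ?W (insert e D) B (\<gamma>(e := Bidirected))
          + (\<Sum>d\<in>{Single u v, Single v u}. ?W (insert e D) B (\<gamma>(e := d)))"
      unfolding dirs_Upair[of en e, OF e] by (subst sum.insert) auto
    also have "\<dots> = ?W D B \<gamma> + t * ?W D (link u v B) \<gamma>"
      unfolding weighted_orientation_Bidirected[of D e en, OF insert.hyps e]
        sum_weighted_orientation_Single[of V u v B e D en, OF assms(2) uv insert.prems(2) insert.hyps(2) e]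
      by (simp add: algebra_simps)
    finally show "(\<Sum>d\<in>dirs en e. ?W (insert e D) B (\<gamma>(e := d)))
        = ?W D B \<gamma> + t * ?W D (link u v B) \<gamma>" .
  qed
  also have "\<dots> = ?T B + t * ?T (link u v B)"
    by (simp add: sum.distrib sum_distrib_left)
  also have "\<dots> = (\<Sum>S\<in>Pow D. t ^ card S * (- 1) ^ comps V (B \<union> edge_rel en S))
      + t * (\<Sum>S\<in>Pow D. t ^ card S * (- 1) ^ comps V (link u v B \<union> edge_rel en S))"
    using insert.prems by (simp add: insert.IH sym_link)
  also have "\<dots> = (\<Sum>S\<in>Pow (insert e D). t ^ card S * (- 1) ^ comps V (B \<union> edge_rel en S))"
  proof -
    have "t ^ card (insert e S) * (- 1) ^ comps V (B \<union> edge_rel en (insert e S))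
        = t * (t ^ card S * (- 1) ^ comps V (link u v B \<union> edge_rel en S))" if "S \<in> Pow D" for S
    proof -
      have "finite S" "e \<notin> S"
        using that insert.hyps by (auto intro: finite_subset)
      then show ?thesis
        by (simp add: edge_rel_insert[of en e, OF e])
    qed
    then show ?thesis
      using insert.hyps by (simp add: sum_Pow_insert sum_distrib_left)
  qed
  finally show ?case .
qed

section \<open>Directed cycles and closed walks\<close>

lemma rtrancl_distinct_path:
  assumes "(x, y) \<in> R\<^sup>*"
  shows "\<exists>vs. vs \<noteq> [] \<and> hd vs = x \<and> last vs = y \<and> distinct vs
    \<and> successively (\<lambda>a b. (a, b) \<in> R) vs"
  using assms
proof (induction rule: converse_rtrancl_induct)
  case base
  show ?case
    by (rule exI[of _ "[y]"]) simp
next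
  case (step x z)
  then obtain vs where vs: "vs \<noteq> []" "hd vs = z" "last vs = y" "distinct vs"
    "successively (\<lambda>a b. (a, b) \<in> R) vs"
    by blast
  show ?case
  proof (cases "x \<in> set vs")
    case True
    then obtain us ws where "vs = us @ x # ws"
      by (meson split_list)
    with vs show ?thesis
      by (intro exI[of _ "x # ws"]) (auto simp: successively_append_iff)
  next
    case False
    with vs step.hyps show ?thesis
      by (intro exI[of _ "x # vs"]) (auto simp: successively_Cons)
  qed
qed

definition steps :: "('v, 'e) multigraph \<Rightarrow> ('e \<Rightarrow> 'v direction) \<Rightarrow> 'v rel" where
  "steps G \<gamma> = edge_rel (ends G) (bidir (edges G) \<gamma>) \<union> arcs (edges G) \<gamma>"

lemma steps_iff_traverses: "(a, b) \<in> steps G \<gamma> \<longleftrightarrow> (\<exists>e\<in>edges G. traverses G \<gamma> e a b)"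
  by (auto simp: steps_def edge_rel_def bidir_def arcs_def traverses_def)

lemma biorientations_conv_dirs: "biorientations G = Pi\<^sub>E (edges G) (dirs (ends G))"
  by (simp add: biorientations_def dirs_def[abs_def])

lemma Single_ends:
  assumes "\<gamma> \<in> biorientations G" "e \<in> edges G" "\<gamma> e = Single a b"
  shows "ends G e = Upair a b"
  using PiE_mem[of \<gamma> "edges G" "dirs (ends G)" e] assms
  by (auto simp: biorientations_conv_dirs dirs_def)

lemma traverses_ends:
  assumes "\<gamma> \<in> biorientations G" "e \<in> edges G" "traverses G \<gamma> e a b"
  shows "ends G e = Upair a b"
  using assms Single_ends by (auto simp: traverses_def)

lemma directed_cycle_steps:
  assumes "directed_cycle G \<gamma> vs es" "i < length vs"
  shows "(vs ! i, vs ! ((i + k) mod length vs)) \<in> (steps G \<gamma>)\<^sup>*"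
proof (induction k)
  case 0
  show ?case using assms by simp
next
  case (Suc k)
  let ?j = "(i + k) mod length vs"
  have j: "?j < length vs"
    using assms by (intro mod_less_divisor) auto
  with assms have "traverses G \<gamma> (es ! ?j) (vs ! ?j) (vs ! (Suc ?j mod length vs))" "es ! ?j \<in> edges G"
    by (auto simp: directed_cycle_def)
  then have "(vs ! ?j, vs ! (Suc ?j mod length vs)) \<in> steps G \<gamma>"
    by (auto simp: steps_iff_traverses)
  moreover have "Suc ?j mod length vs = (i + Suc k) mod length vs"
    by (simp add: mod_Suc_eq)
  ultimately show ?case
    using Suc by (metis rtrancl.rtrancl_into_rtrancl)
qed

text \<open>A return walk is shortened to a simple path, which \<open>e\<close> closes to a cycle; a
  loop is the case of a path with one vertex.\<close>

lemma cycle_through_arc: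
  assumes \<gamma>: "\<gamma> \<in> biorientations G" and e: "e \<in> edges G" "\<gamma> e = Single a b"
    and path: "(b, a) \<in> (steps G \<gamma>)\<^sup>*"
  shows "\<exists>vs es. directed_cycle G \<gamma> vs es \<and> e \<in> set es"
proof -
  from path obtain vs where vs: "vs \<noteq> []" "hd vs = b" "last vs = a" "distinct vs"
    "successively (\<lambda>x y. (x, y) \<in> steps G \<gamma>) vs"
    using rtrancl_distinct_path[OF path] by blast
  let ?n = "length vs"
  have "\<forall>i. \<exists>d. Suc i < ?n \<longrightarrow> d \<in> edges G \<and> traverses G \<gamma> d (vs ! i) (vs ! Suc i)"
    using vs(5) by (auto simp: successively_conv_nth steps_iff_traverses)
  then obtain d where d: "\<And>i. Suc i < ?n \<Longrightarrow> d i \<in> edges G \<and> traverses G \<gamma> (d i) (vs ! i) (vs ! Suc i)"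
    by metis
  define g where "g i = (if Suc i < ?n then d i else e)" for i
  have ends: "vs ! 0 = b" "vs ! (?n - 1) = a"
    using vs by (simp_all add: hd_conv_nth last_conv_nth)
  have g: "g i \<in> edges G \<and> traverses G \<gamma> (g i) (vs ! i) (vs ! (Suc i mod ?n))" if "i < ?n" for i
  proof (cases "Suc i < ?n")
    case True
    with d show ?thesis by (simp add: g_def)
  next
    case False
    with that have i: "Suc i = ?n" by simp
    then have "i = ?n - 1" by simp
    with i e ends show ?thesis
      by (simp add: g_def traverses_def)
  qed
  \<comment> \<open>As the vertices are distinct, an edge can be repeated only if it is traversed
    back and forth, which makes the cycle have length 2 and both its edges equal to
    \<open>e\<close>. But \<open>e\<close> admits only the direction from \<open>a\<close> to
    \<open>b\<close>.\<close>
  have "g i \<noteq> g j" if ij: "i < j" "j < ?n" for i j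
  proof
    assume eq: "g i = g j"
    have i: "Suc i < ?n" "Suc i mod ?n = Suc i"
      using ij by auto
    have "ends G (g i) = Upair (vs ! i) (vs ! Suc i)" "ends G (g j) = Upair (vs ! j) (vs ! (Suc j mod ?n))"
      using traverses_ends[OF \<gamma>] g[of i] g[of j] ij i by auto
    with eq have "vs ! i = vs ! (Suc j mod ?n)" "vs ! j = vs ! Suc i"
      using vs(4) ij i by (auto simp: nth_eq_iff_index_eq)
    moreover have "Suc j mod ?n < ?n"
      using ij by (intro mod_less_divisor) auto
    ultimately have idx: "i = Suc j mod ?n" "j = Suc i"
      using vs(4) ij i by (auto simp: nth_eq_iff_index_eq)
    have n: "?n = Suc j"
    proof (rule ccontr)
      assume "?n \<noteq> Suc j"
      with ij have "Suc j mod ?n = Suc j"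
        by (intro mod_less) auto
      with idx show False
        by simp
    qed
    with idx have "i = 0"
      by simp
    have "g j = e" "vs ! j = a"
      using n ends by (simp_all add: g_def)
    moreover have "traverses G \<gamma> (g i) b (vs ! j)"
      using g[of i] ij i(2) idx(2) \<open>i = 0\<close> ends(1) vs(1) by simp
    ultimately have "traverses G \<gamma> e b a"
      by (metis eq)
    then have "b = a"
      using e(2) unfolding traverses_def
      by (metis direction.distinct(1) direction.inject)
    then have "vs ! i = vs ! j"
      using \<open>i = 0\<close> \<open>vs ! j = a\<close> ends(1) by simp
    with vs(4) ij show False
      by (simp add: nth_eq_iff_index_eq)
  qed
  then have "distinct (map g [0..<?n])"
    by (auto simp: distinct_map inj_on_def) (metis linorder_neqE_nat)
  then have "directed_cycle G \<gamma> vs (map g [0..<?n])"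
    using vs g by (auto simp: directed_cycle_def)
  moreover have "e \<in> set (map g [0..<?n])"
    using vs(1) by (auto simp: g_def intro!: image_eqI[of _ _ "?n - 1"])
  ultimately show ?thesis
    by blast
qed

text \<open>An arc with a return walk lies on a simple cycle by \<open>cycle_through_arc\<close>;
  conversely, the remainder of a cycle through an arc is a return walk for it.\<close>

lemma acyclic_biorientation_iff:
  assumes \<gamma>: "\<gamma> \<in> biorientations G"
  shows "acyclic_biorientation G \<gamma>
    \<longleftrightarrow> acyclic_over (edge_rel (ends G) (bidir (edges G) \<gamma>)) (arcs (edges G) \<gamma>)"
    (is "_ \<longleftrightarrow> ?acyclic")
proof -
  have "?acyclic" if acy: "acyclic_biorientation G \<gamma>"
    unfolding acyclic_over_def steps_def[symmetric]
  proof (intro ballI, clarify)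
    fix a b assume "(a, b) \<in> arcs (edges G) \<gamma>" "(b, a) \<in> (steps G \<gamma>)\<^sup>*"
    then show False
      using cycle_through_arc[OF \<gamma>] acy by (fastforce simp: arcs_def acyclic_biorientation_def)
  qed
  moreover have False if ?acyclic and cyc: "directed_cycle G \<gamma> vs es"
    and e: "e \<in> set es" "\<gamma> e \<noteq> Bidirected" for vs es e
  proof -
    let ?n = "length vs"
    from cyc e obtain i where i: "i < ?n" "e = es ! i"
      by (metis directed_cycle_def in_set_conv_nth)
    let ?j = "Suc i mod ?n"
    have j: "?j < ?n"
      using i by (intro mod_less_divisor) auto
    have "traverses G \<gamma> e (vs ! i) (vs ! ?j)" "e \<in> edges G"
      using cyc e i by (auto simp: directed_cycle_def)
    with e have "(vs ! i, vs ! ?j) \<in> arcs (edges G) \<gamma>"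
      by (auto simp: traverses_def arcs_def)
    \<comment> \<open>From the head of the arc, \<open>?n - 1\<close> further steps along the cycle
      lead back to its tail.\<close>
    moreover have "(?j + (?n - 1)) mod ?n = i"
    proof -
      have "(?j + (?n - 1)) mod ?n = (Suc i + (?n - 1)) mod ?n"
        by (rule mod_add_left_eq)
      also have "Suc i + (?n - 1) = i + ?n"
        using i by simp
      finally show ?thesis
        using i by simp
    qed
    then have "(vs ! ?j, vs ! i) \<in> (steps G \<gamma>)\<^sup>*"
      using directed_cycle_steps[OF cyc j, of "?n - 1"] by simp
    ultimately show False
      using \<open>?acyclic\<close> by (auto simp: acyclic_over_def steps_def)
  qed
  ultimately show ?thesis
    unfolding acyclic_biorientation_def by blast
qed

section \<open>The coefficient of a colouring\<close>

lemma sgn_of_cases: "sgn_of z = 1 \<or> sgn_of z = - 1"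
  by (induction z) auto

definition comp_rel :: "('v, 'e) multigraph \<Rightarrow> 'e set \<Rightarrow> 'v rel" where
  "comp_rel G S = {(u, v) \<in> verts G \<times> verts G. (u, v) \<in> (edge_rel (ends G) S)\<^sup>*}"

lemma equiv_comp_rel: "equiv (verts G) (comp_rel G S)"
  unfolding comp_rel_def using sym_edge_rel by (rule equiv_connected)

section \<open>Orientations compatible with a fixed colouring\<close>

locale signed_colouring =
  fixes G :: "('v, 'e) multigraph" and A :: "fvar set" and lt :: "fvar rel" and \<kappa> :: "'v \<Rightarrow> fvar"
  assumes finite_verts: "finite (verts G)" and finite_edges: "finite (edges G)"
    and ends_subset: "e \<in> edges G \<Longrightarrow> set_uprod (ends G e) \<subseteq> verts G"
    and colours: "\<kappa> \<in> verts G \<rightarrow>\<^sub>E A"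
    and order: "strict_linear_order_on A lt"
begin

definition sign_edges :: "int \<Rightarrow> 'e set" where
  "sign_edges s = {e \<in> edges G. \<exists>u v. ends G e = Upair u v \<and> \<kappa> u = \<kappa> v \<and> sgn_of (\<kappa> u) = s}"

definition neg_verts :: "'v set" where
  "neg_verts = {v \<in> verts G. sgn_of (\<kappa> v) = - 1}"

definition neg_orientations :: "('e \<Rightarrow> 'v direction) set" where
  "neg_orientations = {\<gamma> \<in> Pi\<^sub>E (sign_edges (- 1)) (dirs (ends G)).
     acyclic_over (edge_rel (ends G) (bidir (sign_edges (- 1)) \<gamma>)) (arcs (sign_edges (- 1)) \<gamma>)}"

definition compatible_orientations :: "('e \<Rightarrow> 'v direction) set" where
  "compatible_orientations =
     {\<gamma> \<in> biorientations G. acyclic_biorientation G \<gamma> \<and> compatible G lt \<gamma> \<kappa>}"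

lemma lt_trans: "(x, y) \<in> lt \<Longrightarrow> (y, z) \<in> lt \<Longrightarrow> (x, z) \<in> lt"
  and lt_irrefl: "(x, x) \<notin> lt"
  and lt_total: "x \<in> A \<Longrightarrow> y \<in> A \<Longrightarrow> x \<noteq> y \<Longrightarrow> (x, y) \<in> lt \<or> (y, x) \<in> lt"
  using order unfolding strict_linear_order_on_def
  by (auto dest: transD simp: irrefl_def total_on_def)

lemma lt_antisym: "(x, y) \<in> lt\<^sup>= \<Longrightarrow> (y, x) \<in> lt\<^sup>= \<Longrightarrow> x = y"
  using lt_trans lt_irrefl by blast

lemma ends_mem:
  assumes "e \<in> edges G" "ends G e = Upair u v"
  shows "u \<in> verts G" "v \<in> verts G" "\<kappa> u \<in> A" "\<kappa> v \<in> A"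
  using ends_subset[OF assms(1)] assms(2) colours by auto

lemma mono_edges_eq: "mono_edges G \<kappa> = sign_edges 1 \<union> sign_edges (- 1)"
  using sgn_of_cases by (fastforce simp: mono_edges_def sign_edges_def)

lemma sign_edges_disjoint: "sign_edges 1 \<inter> sign_edges (- 1) = {}"
  by (auto simp: sign_edges_def)

lemma sign_edges_subset: "sign_edges s \<subseteq> edges G"
  by (auto simp: sign_edges_def)

lemma finite_sign_edges: "finite (sign_edges s)"
  using sign_edges_subset finite_edges by (rule finite_subset)

lemma sign_edgesI:
  assumes "e \<in> edges G" "ends G e = Upair u v" "\<kappa> u = \<kappa> v" "sgn_of (\<kappa> u) = s"
  shows "e \<in> sign_edges s"
  using assms unfolding sign_edges_def by blast

lemma sign_edgesD:
  assumes "e \<in> sign_edges s" "ends G e = Upair u v"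
  shows "\<kappa> u = \<kappa> v" "sgn_of (\<kappa> u) = s"
  using assms by (auto simp: sign_edges_def)

lemma compatible_Bidirected:
  assumes "compatible G lt \<gamma> \<kappa>"
  shows "e \<in> sign_edges 1 \<Longrightarrow> \<gamma> e = Bidirected"
    and "\<lbrakk>e \<in> edges G; \<gamma> e = Bidirected\<rbrakk> \<Longrightarrow> e \<in> mono_edges G \<kappa>"
proof -
  show "\<gamma> e = Bidirected" if "e \<in> sign_edges 1"
    using assms that unfolding compatible_def sign_edges_def by blast
  assume e: "e \<in> edges G" "\<gamma> e = Bidirected"
  obtain u v where uv: "ends G e = Upair u v"
    by (cases "ends G e")
  then have vu: "ends G e = Upair v u"
    by auto
  have "(\<kappa> u, \<kappa> v) \<notin> lt" "(\<kappa> v, \<kappa> u) \<notin> lt"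
    using assms e uv vu unfolding compatible_def by (metis direction.distinct(1))+
  then have "\<kappa> u = \<kappa> v"
    using lt_total ends_mem[OF e(1) uv] by blast
  with e uv show "e \<in> mono_edges G \<kappa>"
    by (auto simp: mono_edges_def)
qed

lemma steps_ascend:
  assumes "\<gamma> \<in> biorientations G" "compatible G lt \<gamma> \<kappa>" "e \<in> edges G" "traverses G \<gamma> e a b"
  shows "(\<kappa> a, \<kappa> b) \<in> lt\<^sup>="
proof (rule ccontr)
  assume not: "(\<kappa> a, \<kappa> b) \<notin> lt\<^sup>="
  have ab: "ends G e = Upair a b"
    using assms(1,3,4) by (rule traverses_ends)
  then have ba: "ends G e = Upair b a"
    by auto
  have "(\<kappa> b, \<kappa> a) \<in> lt"
    using not lt_total ends_mem[OF assms(3) ab] by blast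
  then have "\<gamma> e = Single b a"
    using assms ba unfolding compatible_def by blast
  with assms(4) have "a = b"
    unfolding traverses_def by (metis direction.distinct(1) direction.inject)
  with not show False
    by simp
qed

text \<open>Steps never descend in the order of the colours, so a closed walk stays in one colour.\<close>

lemma steps_in_colour:
  assumes \<gamma>: "\<gamma> \<in> biorientations G" "compatible G lt \<gamma> \<kappa>" and "(x, a) \<in> (steps G \<gamma>)\<^sup>*"
  defines "D \<equiv> sign_edges (- 1)"
  shows "(\<kappa> x, \<kappa> a) \<in> lt\<^sup>= \<and> (\<kappa> x = \<kappa> a \<and> sgn_of (\<kappa> a) = - 1
    \<longrightarrow> (x, a) \<in> (edge_rel (ends G) (bidir D \<gamma>) \<union> arcs D \<gamma>)\<^sup>*)"
  using assms(3)
proof (induction rule: converse_rtrancl_induct)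
  case base
  show ?case by simp
next
  case (step x y)
  obtain e where e: "e \<in> edges G" "traverses G \<gamma> e x y"
    using step.hyps(1) by (auto simp: steps_iff_traverses)
  have xy: "(\<kappa> x, \<kappa> y) \<in> lt\<^sup>="
    using steps_ascend \<gamma> e by blast
  with step.IH have le: "(\<kappa> x, \<kappa> a) \<in> lt\<^sup>="
    by (auto intro: lt_trans)
  moreover have "(x, a) \<in> (edge_rel (ends G) (bidir D \<gamma>) \<union> arcs D \<gamma>)\<^sup>*"
    if eq: "\<kappa> x = \<kappa> a" "sgn_of (\<kappa> a) = - 1"
  proof -
    \<comment> \<open>The colour of \<open>y\<close> lies between those of \<open>x\<close> and
      \<open>a\<close>, which agree.\<close>
    have y: "\<kappa> y = \<kappa> x"
      using lt_antisym[OF xy] step.IH eq by auto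
    have en: "ends G e = Upair x y"
      using \<gamma>(1) e by (rule traverses_ends)
    then have "e \<in> D"
      using y eq e(1) unfolding D_def by (intro sign_edgesI[of e x y]) auto
    with e(2) en have "(x, y) \<in> edge_rel (ends G) (bidir D \<gamma>) \<union> arcs D \<gamma>"
      by (auto simp: traverses_def edge_rel_def bidir_def arcs_def)
    with step.IH y eq show ?thesis
      by (metis converse_rtrancl_into_rtrancl)
  qed
  ultimately show ?case
    by blast
qed

text \<open>An arc with a return walk joins equal colours, since neither part can descend. The
  colour is negative because edges of equal positive colour are bidirected, and then the return walk
  can be taken along edges of negative colour as well.\<close>

lemma acyclic_over_neg_edges:
  assumes \<gamma>: "\<gamma> \<in> biorientations G" "compatible G lt \<gamma> \<kappa>"
  defines "D \<equiv> sign_edges (- 1)"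
  shows "acyclic_biorientation G \<gamma> \<longleftrightarrow> acyclic_over (edge_rel (ends G) (bidir D \<gamma>)) (arcs D \<gamma>)"
    (is "_ \<longleftrightarrow> ?neg")
proof -
  have arcs: "arcs D \<gamma> \<subseteq> arcs (edges G) \<gamma>"
    and sub: "edge_rel (ends G) (bidir D \<gamma>) \<union> arcs D \<gamma> \<subseteq> steps G \<gamma>"
    using sign_edges_subset unfolding D_def by (force simp: steps_def arcs_def bidir_def edge_rel_def)+
  have "?neg" if "acyclic_over (edge_rel (ends G) (bidir (edges G) \<gamma>)) (arcs (edges G) \<gamma>)"
    using that arcs rtrancl_mono[OF sub] unfolding acyclic_over_def steps_def[symmetric] by blast
  moreover have "(b, a) \<notin> (steps G \<gamma>)\<^sup>*" if ?neg and ab: "(a, b) \<in> arcs (edges G) \<gamma>" for a b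
  proof
    assume path: "(b, a) \<in> (steps G \<gamma>)\<^sup>*"
    obtain e where e: "e \<in> edges G" "\<gamma> e = Single a b"
      using ab by (auto simp: arcs_def)
    have en: "ends G e = Upair a b"
      using \<gamma>(1) e by (rule Single_ends)
    have "(\<kappa> a, \<kappa> b) \<in> lt\<^sup>="
      using steps_ascend[OF \<gamma> e(1), of a b] e(2) by (simp add: traverses_def)
    then have eq: "\<kappa> a = \<kappa> b"
      using steps_in_colour[OF \<gamma> path] lt_antisym by blast
    then have "e \<in> mono_edges G \<kappa>"
      using e en by (auto simp: mono_edges_def)
    then have "e \<in> D"
      using compatible_Bidirected(1)[OF \<gamma>(2), of e] e(2) by (auto simp: mono_edges_eq D_def)
    then have "(a, b) \<in> arcs D \<gamma>" "sgn_of (\<kappa> a) = - 1"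
      using e(2) sign_edgesD[OF _ en] by (auto simp: arcs_def D_def)
    with \<open>?neg\<close> eq show False
      using steps_in_colour[OF \<gamma> path] by (auto simp: acyclic_over_def D_def)
  qed
  ultimately show ?thesis
    unfolding acyclic_biorientation_iff[OF \<gamma>(1)] acyclic_over_def steps_def[symmetric] by blast
qed

lemma bidir_restrict: "bidir D (restrict \<gamma> D) = bidir D \<gamma>"
  and arcs_restrict: "arcs D (restrict \<gamma> D) = arcs D \<gamma>"
  by (auto simp: bidir_def arcs_def)

text \<open>Compatibility leaves freedom only on the monochromatic edges of negative colour: the
  others are bidirected or point to the larger colour. Hence restriction is injective, and an
  acyclic choice on the free edges extends, with no new cycle by
  \<open>acyclic_over_neg_edges\<close>.\<close>

lemma bij_betw_neg_orientations:
  "bij_betw (\<lambda>\<gamma>. restrict \<gamma> (sign_edges (- 1))) compatible_orientations neg_orientations"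
proof (rule bij_betwI')
  let ?D = "sign_edges (- 1)"
  fix \<gamma> \<gamma>' assume \<gamma>: "\<gamma> \<in> compatible_orientations" and \<gamma>': "\<gamma>' \<in> compatible_orientations"
  have "\<gamma> = \<gamma>'" if eq: "restrict \<gamma> ?D = restrict \<gamma>' ?D"
  proof (rule PiE_ext)
    show "\<gamma> \<in> Pi\<^sub>E (edges G) (dirs (ends G))" "\<gamma>' \<in> Pi\<^sub>E (edges G) (dirs (ends G))"
      using \<gamma> \<gamma>' by (auto simp: compatible_orientations_def biorientations_conv_dirs)
  next
    fix e assume e: "e \<in> edges G"
    obtain u v where uv: "ends G e = Upair u v"
      by (cases "ends G e")
    then have vu: "ends G e = Upair v u"
      by auto
    have c: "compatible G lt \<gamma> \<kappa>" "compatible G lt \<gamma>' \<kappa>"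
      using \<gamma> \<gamma>' by (auto simp: compatible_orientations_def)
    consider "e \<in> ?D" | "e \<in> sign_edges 1" | "\<kappa> u \<noteq> \<kappa> v"
      using e uv sgn_of_cases[of "\<kappa> u"] by (auto simp: sign_edges_def)
    then show "\<gamma> e = \<gamma>' e"
    proof cases
      case 1
      with eq show ?thesis by (metis restrict_apply')
    next
      case 2
      with c show ?thesis by (simp add: compatible_Bidirected)
    next
      case 3
      then have "(\<kappa> u, \<kappa> v) \<in> lt \<or> (\<kappa> v, \<kappa> u) \<in> lt"
        using lt_total ends_mem[OF e uv] by blast
      with c e uv vu show ?thesis
        unfolding compatible_def by metis
    qed
  qed
  then show "restrict \<gamma> ?D = restrict \<gamma>' ?D \<longleftrightarrow> \<gamma> = \<gamma>'"
    by auto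
next
  let ?D = "sign_edges (- 1)"
  fix \<gamma> assume \<gamma>: "\<gamma> \<in> compatible_orientations"
  then have "restrict \<gamma> ?D \<in> Pi\<^sub>E ?D (dirs (ends G))"
    using sign_edges_subset by (fastforce simp: compatible_orientations_def biorientations_conv_dirs)
  moreover have "acyclic_over (edge_rel (ends G) (bidir ?D \<gamma>)) (arcs ?D \<gamma>)"
    using \<gamma> acyclic_over_neg_edges[of \<gamma>] by (simp add: compatible_orientations_def)
  ultimately show "restrict \<gamma> ?D \<in> neg_orientations"
    by (simp add: neg_orientations_def bidir_restrict arcs_restrict)
next
  let ?D = "sign_edges (- 1)"
  fix \<gamma>' assume \<gamma>': "\<gamma>' \<in> neg_orientations"
  then have \<gamma>'_mem: "\<gamma>' \<in> Pi\<^sub>E ?D (dirs (ends G))"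
    by (simp add: neg_orientations_def)
  \<comment> \<open>The ends are unordered, so for an edge between different colours the ascending
    one of its two readings has to be chosen; for all other edges the direction is
    arbitrary.\<close>
  have "\<forall>e. \<exists>d. e \<in> edges G \<and> e \<notin> mono_edges G \<kappa>
      \<longrightarrow> (\<exists>u v. ends G e = Upair u v \<and> (\<kappa> u, \<kappa> v) \<in> lt \<and> d = Single u v)"
  proof
    fix e
    obtain u v where uv: "ends G e = Upair u v"
      by (cases "ends G e")
    then have vu: "ends G e = Upair v u"
      by auto
    have "(\<kappa> u, \<kappa> v) \<in> lt \<or> (\<kappa> v, \<kappa> u) \<in> lt" if "e \<in> edges G" "e \<notin> mono_edges G \<kappa>"
    proof -
      have "\<kappa> u \<noteq> \<kappa> v"
        using that uv by (auto simp: mono_edges_def)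
      then show ?thesis
        using lt_total ends_mem[OF that(1) uv] by blast
    qed
    with uv vu show "\<exists>d. e \<in> edges G \<and> e \<notin> mono_edges G \<kappa>
      \<longrightarrow> (\<exists>u v. ends G e = Upair u v \<and> (\<kappa> u, \<kappa> v) \<in> lt \<and> d = Single u v)"
      by metis
  qed
  from choice[OF this] obtain up where up: "\<And>e. e \<in> edges G \<Longrightarrow> e \<notin> mono_edges G \<kappa>
      \<Longrightarrow> \<exists>u v. ends G e = Upair u v \<and> (\<kappa> u, \<kappa> v) \<in> lt \<and> up e = Single u v"
    by blast
  define \<gamma> where "\<gamma> = (\<lambda>e\<in>edges G. if e \<in> ?D then \<gamma>' e
    else if e \<in> sign_edges 1 then Bidirected else up e)"
  have restr: "restrict \<gamma> ?D = \<gamma>'"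
    using \<gamma>'_mem sign_edges_subset
    by (intro ext) (auto simp: \<gamma>_def restrict_def PiE_def extensional_def)
  have bior: "\<gamma> \<in> biorientations G"
    unfolding biorientations_conv_dirs
  proof (rule PiE_I)
    fix e assume e: "e \<in> edges G"
    consider "e \<in> ?D" | "e \<in> sign_edges 1" "e \<notin> ?D" | "e \<notin> mono_edges G \<kappa>"
      by (auto simp: mono_edges_eq)
    then show "\<gamma> e \<in> dirs (ends G) e"
    proof cases
      case 1
      with \<gamma>'_mem e show ?thesis by (auto simp: \<gamma>_def)
    next
      case 2
      with e show ?thesis by (simp add: \<gamma>_def dirs_def)
    next
      case 3
      with up[OF e 3] e show ?thesis by (auto simp: \<gamma>_def dirs_def mono_edges_eq)
    qed
  qed (simp add: \<gamma>_def)
  have comp: "compatible G lt \<gamma> \<kappa>"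
    unfolding compatible_def
  proof (intro ballI allI impI conjI)
    fix e u v assume e: "e \<in> edges G" and uv: "ends G e = Upair u v"
    show "\<gamma> e = Single u v" if lt: "(\<kappa> u, \<kappa> v) \<in> lt"
    proof -
      have "\<kappa> u \<noteq> \<kappa> v"
        using lt lt_irrefl by metis
      then have e': "e \<notin> mono_edges G \<kappa>"
        using uv by (auto simp: mono_edges_def)
      then obtain u' v' where u': "ends G e = Upair u' v'" "(\<kappa> u', \<kappa> v') \<in> lt" "up e = Single u' v'"
        using up[OF e] by blast
      then have "u' = u \<and> v' = v"
        using uv lt lt_trans lt_irrefl by (metis Upair_inject)
      with u' e e' show ?thesis
        by (auto simp: \<gamma>_def mono_edges_eq)
    qed
    show "\<gamma> e = Bidirected" if "\<kappa> u = \<kappa> v \<and> sgn_of (\<kappa> u) = 1"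
    proof -
      have "e \<in> sign_edges 1"
        using that e uv by (auto simp: sign_edges_def)
      then show ?thesis
        using e sign_edges_disjoint by (auto simp: \<gamma>_def)
    qed
  qed
  have "acyclic_over (edge_rel (ends G) (bidir ?D \<gamma>)) (arcs ?D \<gamma>)"
    using \<gamma>' bidir_restrict[of ?D \<gamma>] arcs_restrict[of ?D \<gamma>]
    by (simp add: restr neg_orientations_def)
  then have "\<gamma> \<in> compatible_orientations"
    using bior comp acyclic_over_neg_edges[OF bior comp] by (simp add: compatible_orientations_def)
  with restr show "\<exists>\<gamma>\<in>compatible_orientations. \<gamma>' = restrict \<gamma> ?D"
    by blast
qed

lemma bidirected_edges_eq:
  assumes "compatible G lt \<gamma> \<kappa>"
  shows "bidirected_edges G \<gamma> = sign_edges 1 \<union> bidir (sign_edges (- 1)) \<gamma>"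
  using compatible_Bidirected[OF assms] sign_edges_subset
  by (auto simp: bidirected_edges_def bidir_def mono_edges_eq)

lemma card_bidirected_edges:
  assumes "compatible G lt \<gamma> \<kappa>"
  shows "card (bidirected_edges G \<gamma>) = card (sign_edges 1) + card (bidir (sign_edges (- 1)) \<gamma>)"
  unfolding bidirected_edges_eq[OF assms] using sign_edges_disjoint
  by (intro card_Un_disjoint) (auto simp: bidir_def finite_sign_edges)

text \<open>A bidirected edge of a compatible orientation is monochromatic, so the edges with both
  ends in \<open>neg_verts\<close> are those of negative colour.\<close>

lemma num_components_neg_subgraph:
  assumes "compatible G lt \<gamma> \<kappa>"
  shows "num_components (neg_subgraph G \<gamma> \<kappa>)
    = comps neg_verts (edge_rel (ends G) (bidir (sign_edges (- 1)) \<gamma>))"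
proof -
  have "{e \<in> bidirected_edges G \<gamma>. set_uprod (ends G e) \<subseteq> neg_verts} = bidir (sign_edges (- 1)) \<gamma>"
  proof (intro equalityI subsetI)
    fix e assume e: "e \<in> {e \<in> bidirected_edges G \<gamma>. set_uprod (ends G e) \<subseteq> neg_verts}"
    obtain u v where uv: "ends G e = Upair u v"
      by (cases "ends G e")
    have "e \<notin> sign_edges 1"
      using e uv sign_edgesD[OF _ uv, of 1] by (auto simp: neg_verts_def)
    with e bidirected_edges_eq[OF assms] show "e \<in> bidir (sign_edges (- 1)) \<gamma>"
      by auto
  next
    fix e assume e: "e \<in> bidir (sign_edges (- 1)) \<gamma>"
    then have D: "e \<in> sign_edges (- 1)"
      by (simp add: bidir_def)
    obtain u v where uv: "ends G e = Upair u v"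
      by (cases "ends G e")
    have "e \<in> edges G"
      using D sign_edges_subset by auto
    then have "set_uprod (ends G e) \<subseteq> neg_verts"
      using sign_edgesD[OF D uv] ends_mem[OF _ uv] uv by (auto simp: neg_verts_def)
    with e bidirected_edges_eq[OF assms]
    show "e \<in> {e \<in> bidirected_edges G \<gamma>. set_uprod (ends G e) \<subseteq> neg_verts}"
      by auto
  qed
  then have "adjacency (neg_subgraph G \<gamma> \<kappa>) = edge_rel (ends G) (bidir (sign_edges (- 1)) \<gamma>)"
    by (simp add: adjacency_def neg_subgraph_def edge_rel_def neg_verts_def)
  then show ?thesis
    by (simp add: num_components_def comps_def neg_subgraph_def neg_verts_def)
qed

lemma sum_compatible_orientations:
  fixes t :: "'a::comm_ring_1"
  shows "(\<Sum>\<gamma>\<in>compatible_orientations. (1 + t) ^ card (bidirected_edges G \<gamma>)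
      * (- 1) ^ num_components (neg_subgraph G \<gamma> \<kappa>))
    = (1 + t) ^ card (sign_edges 1)
      * (\<Sum>S\<in>Pow (sign_edges (- 1)). t ^ card S * (- 1) ^ comps neg_verts (edge_rel (ends G) S))"
proof -
  let ?D = "sign_edges (- 1)"
  let ?h = "\<lambda>\<gamma>. (1 + t) ^ card (bidir ?D \<gamma>) * (- 1) ^ comps neg_verts (edge_rel (ends G) (bidir ?D \<gamma>))"
  have "(\<Sum>\<gamma>\<in>compatible_orientations. (1 + t) ^ card (bidirected_edges G \<gamma>)
      * (- 1) ^ num_components (neg_subgraph G \<gamma> \<kappa>))
    = (\<Sum>\<gamma>\<in>compatible_orientations. (1 + t) ^ card (sign_edges 1) * ?h (restrict \<gamma> ?D))"
    by (intro sum.cong refl)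
      (simp add: compatible_orientations_def card_bidirected_edges num_components_neg_subgraph
        bidir_restrict power_add mult.assoc)
  also have "\<dots> = (\<Sum>\<gamma>\<in>neg_orientations. (1 + t) ^ card (sign_edges 1) * ?h \<gamma>)"
    by (rule sum.reindex_bij_betw[OF bij_betw_neg_orientations])
  also have "\<dots> = (1 + t) ^ card (sign_edges 1) * (\<Sum>\<gamma>\<in>neg_orientations. ?h \<gamma>)"
    by (simp add: sum_distrib_left)
  \<comment> \<open>Cyclic orientations enter with weight 0, which completes the index set to a full
    product; the relation of contracted edges starts empty.\<close>
  also have "(\<Sum>\<gamma>\<in>neg_orientations. ?h \<gamma>)
      = (\<Sum>\<gamma>\<in>Pi\<^sub>E ?D (dirs (ends G)). weighted_orientation t neg_verts (ends G) ?D {} \<gamma>)"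
    unfolding neg_orientations_def weighted_orientation_def Un_empty_left
    by (subst sum.inter_filter) (auto simp: finite_sign_edges intro!: finite_PiE)
  also have "\<dots> = (\<Sum>S\<in>Pow ?D. t ^ card S * (- 1) ^ comps neg_verts ({} \<union> edge_rel (ends G) S))"
  proof (rule sum_weighted_orientation)
    show "set_uprod (ends G e) \<subseteq> neg_verts" if e: "e \<in> ?D" for e
    proof -
      obtain u v where uv: "ends G e = Upair u v"
        by (cases "ends G e")
      have "e \<in> edges G"
        using e sign_edges_subset by auto
      then show ?thesis
        using sign_edgesD[OF e uv] ends_mem[OF _ uv] uv by (auto simp: neg_verts_def)
    qed
  qed (auto simp: finite_sign_edges neg_verts_def finite_verts sym_def)
  finally show ?thesis
    by simp
qed

text \<open>Colours are constant along \<open>S\<close>, so the representative chosen in a component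
  is immaterial. A component of negative colour uses only negative edges of \<open>S\<close> and is
  therefore a component of \<open>neg_verts\<close>; each of these contributes one factor
  -1.\<close>

lemma prod_sgn_components:
  assumes S: "S \<subseteq> mono_edges G \<kappa>"
  shows "(\<Prod>C\<in>verts G // comp_rel G S. sgn_of (\<kappa> (SOME v. v \<in> C)))
    = (- 1) ^ comps neg_verts (edge_rel (ends G) (S \<inter> sign_edges (- 1)))"
proof -
  let ?R = "comp_rel G S" and ?s = "\<lambda>C. sgn_of (\<kappa> (SOME v. v \<in> C))"
  let ?N = "{(u, v) \<in> neg_verts \<times> neg_verts. (u, v) \<in> (edge_rel (ends G) (S \<inter> sign_edges (- 1)))\<^sup>*}"
  have const: "\<kappa> u = \<kappa> v \<and> (sgn_of (\<kappa> u) = - 1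
      \<longrightarrow> (u, v) \<in> (edge_rel (ends G) (S \<inter> sign_edges (- 1)))\<^sup>*)"
    if "(u, v) \<in> (edge_rel (ends G) S)\<^sup>*" for u v
    using that
  proof (induction rule: rtrancl_induct)
    case (step y z)
    then obtain e where e: "e \<in> S" "ends G e = Upair y z"
      by (auto simp: edge_rel_def)
    with S have "e \<in> mono_edges G \<kappa>"
      by blast
    with e(2) have "e \<in> edges G" and yz: "\<kappa> y = \<kappa> z"
      by (auto simp: mono_edges_def)
    have "(y, z) \<in> edge_rel (ends G) (S \<inter> sign_edges (- 1))" if "sgn_of (\<kappa> y) = - 1"
    proof -
      have "e \<in> sign_edges (- 1)"
        using \<open>e \<in> edges G\<close> e(2) yz that by (rule sign_edgesI)
      with e show ?thesis
        by (auto simp: edge_rel_def)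
    qed
    with step.IH yz show ?case
      by (auto intro: rtrancl_into_rtrancl)
  qed simp
  have sub: "(u, v) \<in> (edge_rel (ends G) S)\<^sup>*"
    if "(u, v) \<in> (edge_rel (ends G) (S \<inter> sign_edges (- 1)))\<^sup>*" for u v
    using that by (rule rtrancl_mono[THEN subsetD, rotated]) (auto simp: edge_rel_def)
  have class_eq: "?N `` {v} = ?R `` {v}" if "v \<in> neg_verts" for v
  proof -
    have "(v, y) \<in> ?N \<longleftrightarrow> (v, y) \<in> ?R" for y
      using that const[of v y] sub[of v y] by (auto simp: comp_rel_def neg_verts_def)
    then show ?thesis
      by blast
  qed
  have s: "?s (?R `` {v}) = sgn_of (\<kappa> v)" if "v \<in> verts G" for v
  proof -
    have "v \<in> ?R `` {v}"
      using equiv_comp_rel that by (rule equiv_class_self)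
    then have "(SOME u. u \<in> ?R `` {v}) \<in> ?R `` {v}"
      by (rule someI)
    then show ?thesis
      using const by (auto simp: comp_rel_def)
  qed
  have "{C \<in> verts G // ?R. ?s C = - 1} = neg_verts // ?N"
  proof (intro equalityI subsetI)
    fix C assume C: "C \<in> {C \<in> verts G // ?R. ?s C = - 1}"
    then obtain v where v: "v \<in> verts G" "C = ?R `` {v}"
      by (auto elim: quotientE)
    with C s have neg: "v \<in> neg_verts"
      by (simp add: neg_verts_def)
    show "C \<in> neg_verts // ?N"
      unfolding v(2) class_eq[OF neg, symmetric] using neg by (rule quotientI)
  next
    fix C assume "C \<in> neg_verts // ?N"
    then obtain v where v: "v \<in> neg_verts" "C = ?N `` {v}"
      by (auto elim: quotientE)
    with class_eq s show "C \<in> {C \<in> verts G // ?R. ?s C = - 1}"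
      by (auto simp: neg_verts_def intro: quotientI)
  qed
  then have comps: "comps neg_verts (edge_rel (ends G) (S \<inter> sign_edges (- 1)))
      = card {C \<in> verts G // ?R. ?s C = - 1}"
    by (simp add: comps_def)
  have "finite (verts G // ?R)"
    using finite_verts by (auto simp: quotient_def)
  then have "(\<Prod>C\<in>verts G // ?R. if ?s C = - 1 then - 1 else (1 :: int))
      = (- 1) ^ card (verts G // ?R \<inter> {C. ?s C = - 1})"
    by (subst prod.If_cases) (auto simp only: prod_constant power_one mult_1_right)
  moreover have "(\<Prod>C\<in>verts G // ?R. ?s C) = (\<Prod>C\<in>verts G // ?R. if ?s C = - 1 then - 1 else 1)"
  proof (rule prod.cong[OF refl])
    show "?s C = (if ?s C = - 1 then - 1 else 1)" for C
      by (metis sgn_of_cases)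
  qed
  moreover have "verts G // ?R \<inter> {C. ?s C = - 1} = {C \<in> verts G // ?R. ?s C = - 1}"
    by (simp only: Int_def mem_Collect_eq)
  ultimately show ?thesis
    unfolding comps by (simp only:)
qed

text \<open>A set of monochromatic edges splits into a positive and a negative part. The sign
  depends only on the negative part, so the sum factors, and the positive factor is a binomial
  expansion.\<close>

lemma sum_mono_edges:
  fixes t :: "'a::comm_ring_1"
  shows "(\<Sum>S\<in>Pow (mono_edges G \<kappa>).
      t ^ card S * of_int (\<Prod>C\<in>verts G // comp_rel G S. sgn_of (\<kappa> (SOME v. v \<in> C))))
    = (\<Sum>\<gamma>\<in>compatible_orientations. (1 + t) ^ card (bidirected_edges G \<gamma>)
      * (- 1) ^ num_components (neg_subgraph G \<gamma> \<kappa>))"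
proof -
  let ?P = "sign_edges 1" and ?D = "sign_edges (- 1)"
  let ?n = "\<lambda>S. (- 1 :: 'a) ^ comps neg_verts (edge_rel (ends G) S)"
  have "(\<Sum>S\<in>Pow (mono_edges G \<kappa>).
      t ^ card S * of_int (\<Prod>C\<in>verts G // comp_rel G S. sgn_of (\<kappa> (SOME v. v \<in> C))))
    = (\<Sum>S\<in>Pow (mono_edges G \<kappa>). t ^ card S * ?n (S \<inter> ?D))"
    by (intro sum.cong refl) (simp add: prod_sgn_components)
  also have "\<dots> = (\<Sum>(S, T)\<in>Pow ?P \<times> Pow ?D. t ^ card S * (t ^ card T * ?n T))"
  proof (rule sum.reindex_bij_witness[of _ "\<lambda>(S, T). S \<union> T" "\<lambda>S. (S \<inter> ?P, S \<inter> ?D)"])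
    fix S assume "S \<in> Pow (mono_edges G \<kappa>)"
    then have S: "S = (S \<inter> ?P) \<union> (S \<inter> ?D)"
      by (auto simp: mono_edges_eq)
    then show "(case (S \<inter> ?P, S \<inter> ?D) of (S, T) \<Rightarrow> S \<union> T) = S"
      by auto
    have "card S = card (S \<inter> ?P) + card (S \<inter> ?D)"
      using sign_edges_disjoint by (subst S, intro card_Un_disjoint) (auto simp: finite_sign_edges)
    then show "(case (S \<inter> ?P, S \<inter> ?D) of (S, T) \<Rightarrow> t ^ card S * (t ^ card T * ?n T))
      = t ^ card S * ?n (S \<inter> ?D)"
      by (simp add: power_add mult.assoc)
  qed (use sign_edges_disjoint in \<open>auto simp: mono_edges_eq\<close>)
  also have "\<dots> = (\<Sum>S\<in>Pow ?P. t ^ card S) * (\<Sum>T\<in>Pow ?D. t ^ card T * ?n T)"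
    by (simp add: sum_product sum.cartesian_product)
  finally show ?thesis
    by (simp add: sum_compatible_orientations sum_Pow_power_card finite_sign_edges)
qed

end

section \<open>Expansions in power sums\<close>

text \<open>Structural induction: formally distinct copies make the constructors injective, so no
  summand is lost when values coincide. \<open>Neg\<close> changes the sign outside the power and
  gives the factor -1, whereas \<open>Eps\<close> changes the value inside the power and gives
  \<open>(- 1) ^ n\<close>.\<close>

lemma power_sum_of_formal_sum:
  assumes n: "n \<ge> 1"
  shows "formally_summable (\<lambda>z. of_int (sgn_of z) * value_of z ^ n) (Var f)
    \<and> power_sum_of n f = formal_sum (\<lambda>z. of_int (sgn_of z) * value_of z ^ n) (Var f)"
proof (induction f)
  case One
  show ?case by (simp add: formal_sum_finite)
next
  case Qvar
  show ?case by (simp add: formal_sum_finite)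
next
  case (Xfin k)
  have "inj_on VX {1..k}"
    by (auto intro: inj_onI)
  then show ?case
    by (simp add: formal_sum_finite sum.reindex)
next
  case Xinf
  have inj: "inj_on VX {1..}"
    by (auto intro: inj_onI)
  show ?case
    using formally_summable_mvar_power[OF n]
    unfolding Var.simps formally_summable_reindex[OF inj] formal_sum_reindex[OF inj]
    by (simp add: power_sum_def)
next
  case (Add f g)
  have inj: "inj_on InL (Var f)" "inj_on InR (Var g)"
    by (auto intro: inj_onI)
  have "InL ` Var f \<inter> InR ` Var g = {}"
    by auto
  with Add show ?case
    by (simp add: formally_summable_Un formal_sum_Un_disjoint formally_summable_reindex[OF inj(1)]
        formally_summable_reindex[OF inj(2)] formal_sum_reindex[OF inj(1)] formal_sum_reindex[OF inj(2)])
next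
  case (Neg f)
  have inj: "inj_on Bar (Var f)"
    by (auto intro: inj_onI)
  have eq: "of_int (sgn_of (Bar z)) * value_of (Bar z) ^ n
      = mconst (- 1) * (of_int (sgn_of z) * value_of z ^ n)" for z
    by (simp add: mconst_uminus)
  show ?case
    using Neg formally_summable_mult_left[OF Neg[THEN conjunct1], of "\<lambda>_. - 1"]
      formal_sum_mult_left[OF Neg[THEN conjunct1], of "- 1"]
    unfolding Var.simps formally_summable_reindex[OF inj] formal_sum_reindex[OF inj] eq
    by (simp add: mconst_uminus)
next
  case (Eps f)
  have inj: "inj_on NegVal (Var f)"
    by (auto intro: inj_onI)
  have eq: "of_int (sgn_of (NegVal z)) * value_of (NegVal z) ^ n
      = mconst ((- 1) ^ n) * (of_int (sgn_of z) * value_of z ^ n)" for z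
    by (simp add: mconst_power mconst_uminus power_minus[of "value_of z"])
  show ?case
    using Eps formally_summable_mult_left[OF Eps[THEN conjunct1], of "\<lambda>_. (- 1) ^ n"]
      formal_sum_mult_left[OF Eps[THEN conjunct1], of "(- 1) ^ n"]
    unfolding Var.simps formally_summable_reindex[OF inj] formal_sum_reindex[OF inj] eq
    by (simp add: mconst_power mconst_uminus)
next
  case (Mul f g)
  have inj: "inj_on (\<lambda>p. ProdV (fst p) (snd p)) (Var f \<times> Var g)"
    by (auto intro: inj_onI)
  have Var: "Var (Mul f g) = (\<lambda>p. ProdV (fst p) (snd p)) ` (Var f \<times> Var g)"
    by force
  have eq: "of_int (sgn_of (ProdV z w)) * value_of (ProdV z w) ^ n
      = of_int (sgn_of z) * value_of z ^ n * (of_int (sgn_of w) * value_of w ^ n)" for z w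
    by (simp add: power_mult_distrib)
  show ?case
    using formal_sum_mult[OF Mul(1)[THEN conjunct1] Mul(2)[THEN conjunct1]] Mul
    unfolding Var formally_summable_reindex[OF inj] formal_sum_reindex[OF inj] eq
    by simp
qed

text \<open>Signs square to 1, so multiplying the signed family by them once more removes
  them.\<close>

lemma formally_summable_value_power:
  assumes "n \<ge> 1"
  shows "formally_summable (\<lambda>z. value_of z ^ n) (Var f)"
proof -
  have "mconst (of_int (sgn_of z)) * (of_int (sgn_of z) * value_of z ^ n) = value_of z ^ n" for z
    using sgn_of_cases[of z] by (auto simp: mconst_uminus)
  then show ?thesis
    using formally_summable_mult_left[OF power_sum_of_formal_sum[OF assms, THEN conjunct1],
        of "\<lambda>z. of_int (sgn_of z)" f] by simp
qed

section \<open>Expansion over edge sets for an arbitrary signed alphabet\<close>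

locale weighted_graph =
  fixes G :: "('v, 'e) multigraph" and w :: "'v \<Rightarrow> nat"
  assumes weighted: "vertex_weighted_graph G w"
begin

lemma finite_verts: "finite (verts G)" and finite_edges: "finite (edges G)"
  and ends_subset: "e \<in> edges G \<Longrightarrow> set_uprod (ends G e) \<subseteq> verts G"
  and weight_pos: "v \<in> verts G \<Longrightarrow> w v \<ge> 1"
  using weighted by (auto simp: vertex_weighted_graph_def Suc_le_eq)

definition pieces :: "'e set \<Rightarrow> 'v set set" where
  "pieces S = verts G // comp_rel G S"

lemma Union_pieces: "\<Union> (pieces S) = verts G"
  unfolding pieces_def using equiv_comp_rel by (rule Union_quotient)

lemma finite_pieces: "finite (pieces S)"
  using finite_verts by (auto simp: pieces_def quotient_def)

lemma pieces_subset: "C \<in> pieces S \<Longrightarrow> C \<subseteq> verts G"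
  using Union_pieces by blast

lemma finite_piece: "C \<in> pieces S \<Longrightarrow> finite C"
  using pieces_subset finite_verts by (rule finite_subset)

lemma piece_nonempty: "C \<in> pieces S \<Longrightarrow> C \<noteq> {}"
  unfolding pieces_def using equiv_comp_rel by (rule in_quotient_imp_non_empty)

lemma some_in_piece: "C \<in> pieces S \<Longrightarrow> (SOME v. v \<in> C) \<in> C"
  using piece_nonempty by (meson ex_in_conv someI_ex)

lemma piece_of: "C \<in> pieces S \<Longrightarrow> v \<in> C \<Longrightarrow> comp_rel G S `` {v} = C"
  unfolding pieces_def using equiv_comp_rel
  by (metis Image_singleton_iff equiv_class_eq quotientE)

lemma class_mem: "v \<in> verts G \<Longrightarrow> comp_rel G S `` {v} \<in> pieces S"
  unfolding pieces_def by (rule quotientI)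

lemma prod_verts: "(\<Prod>v\<in>verts G. h v) = (\<Prod>C\<in>pieces S. \<Prod>v\<in>C. h v)"
proof -
  have "(\<Prod>v\<in>\<Union> (pieces S). h v) = (\<Prod>C\<in>pieces S. \<Prod>v\<in>C. h v)"
    using finite_piece quotient_disj[OF equiv_comp_rel, of _ G S] unfolding pieces_def
    by (subst prod.Union_disjoint) (blast | simp)+
  then show ?thesis
    by (simp add: Union_pieces)
qed

lemma sum_weight_piece: "C \<in> pieces S \<Longrightarrow> (\<Sum>v\<in>C. w v) \<ge> 1"
proof -
  assume C: "C \<in> pieces S"
  then obtain v where v: "v \<in> C"
    using piece_nonempty by blast
  then have "w v \<le> (\<Sum>v\<in>C. w v)"
    using finite_piece[OF C] by (simp add: member_le_sum)
  with weight_pos v pieces_subset[OF C] show ?thesis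
    by (meson in_mono le_trans)
qed

definition spread :: "'e set \<Rightarrow> ('v set \<Rightarrow> 'c) \<Rightarrow> 'v \<Rightarrow> 'c" where
  "spread S g = (\<lambda>v\<in>verts G. g (comp_rel G S `` {v}))"

lemma spread_piece: "C \<in> pieces S \<Longrightarrow> v \<in> C \<Longrightarrow> spread S g v = g C"
  using pieces_subset by (auto simp: spread_def piece_of)

lemma inj_on_spread: "inj_on (spread S) (pieces S \<rightarrow>\<^sub>E A)"
proof (rule inj_onI)
  fix g h assume gh: "g \<in> pieces S \<rightarrow>\<^sub>E A" "h \<in> pieces S \<rightarrow>\<^sub>E A" and eq: "spread S g = spread S h"
  have "g C = h C" if "C \<in> pieces S" for C
    using eq spread_piece[OF that some_in_piece[OF that]] by metis
  with gh show "g = h"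
    by (auto intro: PiE_ext)
qed

text \<open>All edges of \<open>S\<close> are monochromatic exactly when the colouring is constant
  on the components of \<open>(V, S)\<close>. With \<open>inj_on_spread\<close>, choosing a variable
  for each component thus amounts to choosing such a colouring.\<close>

lemma spread_image:
  assumes S: "S \<subseteq> edges G"
  shows "spread S ` (pieces S \<rightarrow>\<^sub>E A) = {\<kappa> \<in> verts G \<rightarrow>\<^sub>E A. S \<subseteq> mono_edges G \<kappa>}"
proof (intro equalityI subsetI)
  fix \<kappa> assume "\<kappa> \<in> spread S ` (pieces S \<rightarrow>\<^sub>E A)"
  then obtain g where g: "g \<in> pieces S \<rightarrow>\<^sub>E A" "\<kappa> = spread S g"
    by blast
  then have "\<kappa> \<in> verts G \<rightarrow>\<^sub>E A"
    using class_mem by (auto simp: spread_def)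
  moreover have "e \<in> mono_edges G \<kappa>" if e: "e \<in> S" for e
  proof -
    obtain u v where uv: "ends G e = Upair u v"
      by (cases "ends G e")
    have E: "e \<in> edges G"
      using e S by auto
    then have V: "u \<in> verts G" "v \<in> verts G"
      using ends_subset[of e] uv by auto
    have "(u, v) \<in> edge_rel (ends G) S"
      using e uv by (auto simp: edge_rel_def)
    with V have "(u, v) \<in> comp_rel G S"
      by (auto simp: comp_rel_def)
    then have "comp_rel G S `` {u} = comp_rel G S `` {v}"
      by (rule equiv_class_eq[OF equiv_comp_rel])
    with V have "\<kappa> u = \<kappa> v"
      by (simp add: g spread_def)
    with E uv show ?thesis
      by (auto simp: mono_edges_def)
  qed
  ultimately show "\<kappa> \<in> {\<kappa> \<in> verts G \<rightarrow>\<^sub>E A. S \<subseteq> mono_edges G \<kappa>}"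
    by blast
next
  fix \<kappa> assume \<kappa>: "\<kappa> \<in> {\<kappa> \<in> verts G \<rightarrow>\<^sub>E A. S \<subseteq> mono_edges G \<kappa>}"
  have const: "\<kappa> u = \<kappa> v" if "(u, v) \<in> (edge_rel (ends G) S)\<^sup>*" for u v
    using that
  proof (induction rule: rtrancl_induct)
    case (step y z)
    then obtain e where e: "e \<in> S" "ends G e = Upair y z"
      by (auto simp: edge_rel_def)
    with \<kappa> have "e \<in> mono_edges G \<kappa>"
      by blast
    with e(2) step.IH show ?case
      by (auto simp: mono_edges_def)
  qed simp
  \<comment> \<open>The colour is read off at an arbitrary vertex of the component; by
    \<open>const\<close> the choice does not matter.\<close>
  let ?g = "\<lambda>C\<in>pieces S. \<kappa> (SOME v. v \<in> C)"
  have "?g \<in> pieces S \<rightarrow>\<^sub>E A"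
    using \<kappa> some_in_piece pieces_subset by (fastforce simp: PiE_iff)
  moreover have "\<kappa> v = spread S ?g v" for v
  proof (cases "v \<in> verts G")
    case True
    then have "(SOME u. u \<in> comp_rel G S `` {v}) \<in> comp_rel G S `` {v}"
      using some_in_piece class_mem by blast
    then have "\<kappa> (SOME u. u \<in> comp_rel G S `` {v}) = \<kappa> v"
      using const by (auto simp: comp_rel_def)
    with True class_mem show ?thesis
      by (simp add: spread_def)
  next
    case False
    with \<kappa> show ?thesis
      by (auto simp: spread_def)
  qed
  ultimately show "\<kappa> \<in> spread S ` (pieces S \<rightarrow>\<^sub>E A)"
    by (intro image_eqI[of _ _ ?g] ext)
qed

definition piece_sign :: "('c \<Rightarrow> int) \<Rightarrow> 'e set \<Rightarrow> ('v \<Rightarrow> 'c) \<Rightarrow> int" where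
  "piece_sign sg S \<kappa> = (\<Prod>C\<in>pieces S. sg (\<kappa> (SOME v. v \<in> C)))"

text \<open>Expanding the product picks one variable per component, raised to the total weight, and
  \<open>spread\<close> distributes this power over the vertices. Colourings in which
  \<open>S\<close> is not monochromatic are added with coefficient 0, so that the index set no
  longer depends on \<open>S\<close> and the sum over \<open>S\<close> can be moved inside.\<close>

lemma prod_pieces:
  fixes A :: "'c set" and sg :: "'c \<Rightarrow> int" and val :: "'c \<Rightarrow> series"
  assumes S: "S \<subseteq> edges G"
    and summable: "\<And>n. n \<ge> 1 \<Longrightarrow> formally_summable (\<lambda>z. of_int (sg z) * val z ^ n) A"
  defines "F \<equiv> \<lambda>\<kappa>. mconst (if S \<subseteq> mono_edges G \<kappa> then of_int (piece_sign sg S \<kappa>) else 0)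
    * (\<Prod>v\<in>verts G. val (\<kappa> v) ^ w v)"
  shows "formally_summable F (verts G \<rightarrow>\<^sub>E A)"
    and "(\<Prod>C\<in>pieces S. formal_sum (\<lambda>z. of_int (sg z) * val z ^ (\<Sum>v\<in>C. w v)) A)
      = formal_sum F (verts G \<rightarrow>\<^sub>E A)"
proof -
  let ?F = "\<lambda>g. \<Prod>C\<in>pieces S. of_int (sg (g C)) * val (g C) ^ (\<Sum>v\<in>C. w v)"
  let ?K = "{\<kappa> \<in> verts G \<rightarrow>\<^sub>E A. S \<subseteq> mono_edges G \<kappa>}"
  have prod: "formally_summable ?F (pieces S \<rightarrow>\<^sub>E A)
    \<and> (\<Prod>C\<in>pieces S. formal_sum (\<lambda>z. of_int (sg z) * val z ^ (\<Sum>v\<in>C. w v)) A)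
      = formal_sum ?F (pieces S \<rightarrow>\<^sub>E A)"
    using finite_pieces summable sum_weight_piece by (intro formal_sum_prod) auto
  have eq: "F (spread S g) = ?F g" if "g \<in> pieces S \<rightarrow>\<^sub>E A" for g
  proof -
    have "S \<subseteq> mono_edges G (spread S g)"
      using that spread_image[OF S, of A] by blast
    moreover have "piece_sign sg S (spread S g) = (\<Prod>C\<in>pieces S. sg (g C))"
      unfolding piece_sign_def by (intro prod.cong) (auto simp: spread_piece some_in_piece)
    moreover have "(\<Prod>v\<in>verts G. val (spread S g v) ^ w v)
        = (\<Prod>C\<in>pieces S. val (g C) ^ (\<Sum>v\<in>C. w v))"
      unfolding prod_verts[of _ S] by (intro prod.cong) (simp_all add: spread_piece flip: Groups_Big.power_sum)
    ultimately show ?thesis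
      by (simp add: F_def mconst_prod mconst_of_int prod.distrib)
  qed
  have K: "formally_summable F ?K" "formal_sum F ?K = formal_sum ?F (pieces S \<rightarrow>\<^sub>E A)"
    unfolding spread_image[OF S, of A, symmetric] formally_summable_reindex[OF inj_on_spread]
      formal_sum_reindex[OF inj_on_spread]
    using prod eq by (auto cong: formally_summable_cong formal_sum_cong)
  moreover have "formally_summable F ?K \<longleftrightarrow> formally_summable F (verts G \<rightarrow>\<^sub>E A)"
    "formal_sum F ?K = formal_sum F (verts G \<rightarrow>\<^sub>E A)"
    by (rule formal_sum_mono_neutral; auto simp: F_def)+
  ultimately show "formally_summable F (verts G \<rightarrow>\<^sub>E A)"
    "(\<Prod>C\<in>pieces S. formal_sum (\<lambda>z. of_int (sg z) * val z ^ (\<Sum>v\<in>C. w v)) A)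
      = formal_sum F (verts G \<rightarrow>\<^sub>E A)"
    using prod by auto
qed

lemma sum_edge_subsets:
  fixes A :: "'c set" and sg :: "'c \<Rightarrow> int" and val :: "'c \<Rightarrow> series"
  assumes summable: "\<And>n. n \<ge> 1 \<Longrightarrow> formally_summable (\<lambda>z. of_int (sg z) * val z ^ n) A"
  shows "(\<Sum>S\<in>Pow (edges G). mconst (t ^ card S)
      * (\<Prod>C\<in>pieces S. formal_sum (\<lambda>z. of_int (sg z) * val z ^ (\<Sum>v\<in>C. w v)) A))
    = formal_sum (\<lambda>\<kappa>. mconst (\<Sum>S\<in>Pow (mono_edges G \<kappa>). t ^ card S * of_int (piece_sign sg S \<kappa>))
        * (\<Prod>v\<in>verts G. val (\<kappa> v) ^ w v)) (verts G \<rightarrow>\<^sub>E A)"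
proof -
  let ?c = "\<lambda>S \<kappa>. if S \<subseteq> mono_edges G \<kappa> then of_int (piece_sign sg S \<kappa>) else 0"
  let ?v = "\<lambda>\<kappa>. \<Prod>v\<in>verts G. val (\<kappa> v) ^ w v"
  have "(\<Sum>S\<in>Pow (edges G). mconst (t ^ card S)
      * (\<Prod>C\<in>pieces S. formal_sum (\<lambda>z. of_int (sg z) * val z ^ (\<Sum>v\<in>C. w v)) A))
    = (\<Sum>S\<in>Pow (edges G).
        formal_sum (\<lambda>\<kappa>. mconst (t ^ card S) * (mconst (?c S \<kappa>) * ?v \<kappa>)) (verts G \<rightarrow>\<^sub>E A))"
    by (intro sum.cong refl) (simp add: prod_pieces[OF _ summable] formal_sum_mult_left)
  also have "\<dots> = formal_sum (\<lambda>\<kappa>. \<Sum>S\<in>Pow (edges G).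
      mconst (t ^ card S) * (mconst (?c S \<kappa>) * ?v \<kappa>)) (verts G \<rightarrow>\<^sub>E A)"
    using finite_edges
    by (intro formal_sum_sum formally_summable_mult_left prod_pieces summable) auto
  also have "\<dots> = formal_sum (\<lambda>\<kappa>. mconst (\<Sum>S\<in>Pow (mono_edges G \<kappa>). t ^ card S * of_int (piece_sign sg S \<kappa>))
        * ?v \<kappa>) (verts G \<rightarrow>\<^sub>E A)"
  proof (rule formal_sum_cong)
    fix \<kappa>
    have "(\<Sum>S\<in>Pow (mono_edges G \<kappa>). t ^ card S * of_int (piece_sign sg S \<kappa>))
        = (\<Sum>S\<in>Pow (edges G). t ^ card S * ?c S \<kappa>)"
      using finite_edges by (intro sum.mono_neutral_cong_left) (auto simp: mono_edges_def)
    then show "(\<Sum>S\<in>Pow (edges G). mconst (t ^ card S) * (mconst (?c S \<kappa>) * ?v \<kappa>))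
        = mconst (\<Sum>S\<in>Pow (mono_edges G \<kappa>). t ^ card S * of_int (piece_sign sg S \<kappa>)) * ?v \<kappa>"
      by (simp add: mconst_sum mconst_mult sum_distrib_right mult.assoc)
  qed
  finally show ?thesis .
qed

text \<open>With all signs +1 every \<open>piece_sign\<close> is 1, and the coefficient of a
  colouring becomes the binomial expansion of its power of \<open>1 + t\<close>.\<close>

lemma XB_power_sum:
  "XB G w = (\<Sum>S\<in>Pow (edges G). mconst ([:0, 1:] ^ card S)
     * (\<Prod>C\<in>pieces S. power_sum (\<Sum>v\<in>C. w v)))"
proof -
  let ?sg = "\<lambda>_ :: nat. 1 :: int" and ?val = "\<lambda>i. mvar (X i) :: series"
  have s: "formally_summable (\<lambda>i. of_int (?sg i) * ?val i ^ n) {1..}" if "n \<ge> 1" for n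
    using formally_summable_mvar_power[OF that] by simp
  have coeff: "[:1, 1:] ^ card (mono_edges G \<kappa>)
      = (\<Sum>S\<in>Pow (mono_edges G \<kappa>). [:0, 1:] ^ card S * of_int (piece_sign ?sg S \<kappa>))"
    for \<kappa> :: "'v \<Rightarrow> nat"
  proof -
    have "finite (mono_edges G \<kappa>)"
      using finite_edges by (simp add: mono_edges_def)
    then show ?thesis
      by (simp add: piece_sign_def sum_Pow_power_card one_pCons)
  qed
  show ?thesis
    using sum_edge_subsets[OF s, of "[:0, 1:]"] unfolding XB_def coeff
    by (simp add: power_sum_def)
qed

text \<open>The power sum expansion is built by the very rules of \<open>plethysm_rel\<close>; the
  power sums have index at least 1 because a component is nonempty and weights are positive.\<close>

lemma plethysm_XB:
  "plethysm (XB G w) f = (\<Sum>S\<in>Pow (edges G). mconst ([:0, 1:] ^ card S)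
     * (\<Prod>C\<in>pieces S. power_sum_of (\<Sum>v\<in>C. w v) f))"
  unfolding XB_power_sum using sum_weight_piece
  by (intro plethysm_eqI plethysm_rel_sum plethysm_rel.mult plethysm_rel.const plethysm_rel_prod
      plethysm_rel.power_sum)

end

theorem theorem2:
  fixes G :: "('v, 'e) multigraph"
    and w :: "'v \<Rightarrow> nat"
    and f :: expr
    and lt :: "fvar rel"
  assumes "vertex_weighted_graph G w"
    and "strict_linear_order_on (Var f) lt"
  shows "formally_summable (pair_term G w) (admissible_pairs G f lt)
    \<and> plethysm (XB G w) f = formal_sum (pair_term G w) (admissible_pairs G f lt)"
proof -
  interpret weighted_graph G w
    using assms(1) by unfold_locales
  let ?K = "verts G \<rightarrow>\<^sub>E Var f" and ?t = "[:0, 1:] :: complex poly"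
  let ?I = "\<lambda>\<kappa>. {\<gamma> \<in> biorientations G. acyclic_biorientation G \<gamma> \<and> compatible G lt \<gamma> \<kappa>}"
  let ?c = "\<lambda>\<kappa> \<gamma>. (1 + ?t) ^ card (bidirected_edges G \<gamma>) * (- 1) ^ num_components (neg_subgraph G \<gamma> \<kappa>)"
  let ?v = "\<lambda>\<kappa>. \<Prod>v\<in>verts G. value_of (\<kappa> v) ^ w v"
  let ?swap = "\<lambda>p. (snd p, fst p)"
  have signed: "signed_colouring G (Var f) lt \<kappa>" if "\<kappa> \<in> ?K" for \<kappa>
    using that finite_verts finite_edges ends_subset assms(2) by unfold_locales
  have K: "formally_summable ?v ?K"
    using formal_sum_prod[of "verts G" "\<lambda>v z. value_of z ^ w v" "\<lambda>_. Var f"]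
      finite_verts formally_summable_value_power weight_pos by auto
  have I: "finite (?I \<kappa>)" for \<kappa>
    using finite_edges by (intro finite_Collect_conjI disjI1) (simp add: biorientations_conv_dirs finite_PiE)
  \<comment> \<open>Grouping the pairs by their colouring puts the possibly infinite choice outside
    and leaves finitely many orientations in each fibre.\<close>
  have pairs: "admissible_pairs G f lt = ?swap ` Sigma ?K ?I"
    by (force simp: admissible_pairs_def)
  have inj: "inj_on ?swap (Sigma ?K ?I)"
    by (auto intro: inj_onI)
  have t: "1 + ?t = [:1, 1:]"
    by (simp add: one_pCons)
  have pair_eq: "pair_term G w (?swap p) = mconst (?c (fst p) (snd p)) * ?v (fst p)" for p
    unfolding t by (simp add: pair_term_def case_prod_beta mconst_mult mconst_power mconst_uminus)
  have "formal_sum (pair_term G w) (admissible_pairs G f lt)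
      = formal_sum (\<lambda>\<kappa>. mconst (\<Sum>\<gamma>\<in>?I \<kappa>. ?c \<kappa> \<gamma>) * ?v \<kappa>) ?K"
    unfolding pairs formal_sum_reindex[OF inj] pair_eq using K I by (rule formal_sum_Sigma)
  also have "\<dots> = formal_sum (\<lambda>\<kappa>. mconst (\<Sum>S\<in>Pow (mono_edges G \<kappa>).
      ?t ^ card S * of_int (piece_sign sgn_of S \<kappa>)) * ?v \<kappa>) ?K"
  proof (rule formal_sum_cong)
    fix \<kappa> assume "\<kappa> \<in> ?K"
    then interpret col: signed_colouring G "Var f" lt \<kappa>
      by (rule signed)
    have "piece_sign sgn_of S \<kappa> = (\<Prod>C\<in>verts G // comp_rel G S. sgn_of (\<kappa> (SOME v. v \<in> C)))" for S
      by (simp add: piece_sign_def pieces_def)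
    then show "mconst (\<Sum>\<gamma>\<in>?I \<kappa>. ?c \<kappa> \<gamma>) * ?v \<kappa>
      = mconst (\<Sum>S\<in>Pow (mono_edges G \<kappa>). ?t ^ card S * of_int (piece_sign sgn_of S \<kappa>)) * ?v \<kappa>"
      using col.sum_mono_edges[of ?t] by (simp add: col.compatible_orientations_def)
  qed
  also have "\<dots> = (\<Sum>S\<in>Pow (edges G). mconst (?t ^ card S)
     * (\<Prod>C\<in>pieces S. formal_sum (\<lambda>z. of_int (sgn_of z) * value_of z ^ (\<Sum>v\<in>C. w v)) (Var f)))"
    using power_sum_of_formal_sum by (intro sum_edge_subsets[symmetric]) auto
  also have "\<dots> = plethysm (XB G w) f"
    unfolding plethysm_XB using power_sum_of_formal_sum sum_weight_piece
    by (intro sum.cong prod.cong refl arg_cong2[of _ _ _ _ "(*)"]) auto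
  finally have "plethysm (XB G w) f = formal_sum (pair_term G w) (admissible_pairs G f lt)" ..
  moreover have "formally_summable (pair_term G w) (admissible_pairs G f lt)"
    unfolding pairs formally_summable_reindex[OF inj] pair_eq using K I by (rule formal_sum_Sigma)
  ultimately show ?thesis
    by blast
qed

end
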